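(* Let $k$ be an algebraically closed field, let $V$ and $W$ be irreducible affine algebraic varieties over $k$, and let $u : V \rightarrow W$ be a finite dominant morphism. Let $n = [k(V):k(W)]_{s}$ be the separable degree and assume that $W$ is normal. Then, with the open subsets $U_m(u) \subset W$ ($m \geq 1$) defined in the context: (i) for all $y \in W$, $|u^{-1}(y)| \leq n$; (ii) $\{ y \in W : |u^{-1}(y)| = n \} = U_{n}(u)$; (iii) for all integers $m \geq 1$, $\{ y \in W : |u^{-1}(y)| \geq m \} = U_{m}(u)$.
   Context: Varieties are classical algebraic varieties over the algebraically closed field $k$ with the Zariski topology; $|A|$ is the number of elements of a set $A$ (an integer or $\infty$). For an irreducible affine variety $Z$, $k[Z]$ is its ring of regular functions and $k(Z)$ its field of fractions. For a dominant $u: V\to W$ the injection $k[W]\to k[V]$, $f\mapsto f\circ u$, is used to view $k[W]\subset k[V]$ and $k(W)\subset k(V)$. $[E:F]_s$ denotes the separable degree of a field extension. Associated variety $\hat V$: for a dominant morphism $u: V \to W$ of irreducible affine varieties with $\dim V=\dim W$ (which holds when $u$ is finite and dominant), there exist an irreducible affine variety $\hat V$ and dominant morphisms $\hat u_0: V\to\hat V$, $\hat u_1:\hat V\to W$ such that: $\dim \hat V=\dim W$, $u=\hat u_1\circ\hat u_0$, $k(\hat V)$ is separable over $k(W)$ and $[k(\hat V):k(W)]=[k(V):k(W)]_s$; $\hat u_0$ is finite and bijective; $|u^{-1}(y)|=|\hat u_1^{-1}(y)|$ for all $y\in W$; and $u$ is finite if and only if $\hat u_1$ is finite. Fix such $\hat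 V,\hat u_0,\hat u_1$ (when $k(V)/k(W)$ is separable one takes $\hat V=V$, $\hat u_0=\mathrm{Id}$, $\hat u_1=u$). Sets $U_m(F,W)$: for a monic polynomial $F(T)=a_0+a_1T+\cdots+a_{d-1}T^{d-1}+T^d\in k[W][T]$ and $y\in W$, put $F(y,T)=a_0(y)+a_1(y)T+\cdots+a_{d-1}(y)T^{d-1}+T^d\in k[T]$ and $\mathrm{Root}(F,y)=\{z\in k: F(y,z)=0\}$. For $m\ge 1$, $U_m(F,W)=\{y\in W: |\mathrm{Root}(F,y)|\ge m\}$, which is an open subset of $W$. Sets $U_m(u)$: with $n=[k(V):k(W)]_s$, let $\mathcal P$ be the set of monic polynomials $P$ of degree $n$ such that $P$ is the minimal polynomial over $k(W)$ of some $\xi\in k[\hat V]$. Since $W$ is normal and $u$ is finite, $\mathcal P\subset k[W][T]$. For $m\ge1$, $U_m(u)=\bigcup_{P\in\mathcal P}U_m(P,W)$. *)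

theory Defs
  imports
    "HOL-Analysis.Abstract_Topology"
    "HOL-Library.Extended_Nat"
    "HOL-Computational_Algebra.Computational_Algebra"
begin

definition ecard :: "'a set \<Rightarrow> enat" where
  "ecard A = (if finite A then enat (card A) else \<infinity>)"


section \<open>Affine varieties\<close>

text \<open>Affine space of dimension \<open>CARD('n)\<close> over \<open>'k\<close> is the type \<open>'n \<Rightarrow> 'k\<close>.\<close>

inductive_set polynomial_functions :: "(('n::finite \<Rightarrow> 'k::field) \<Rightarrow> 'k) set" where
  const: "(\<lambda>_. c) \<in> polynomial_functions"
| coord: "(\<lambda>x. x i) \<in> polynomial_functions"
| add: "f \<in> polynomial_functions \<Longrightarrow> g \<in> polynomial_functions \<Longrightarrow>
    (\<lambda>x. f x + g x) \<in> polynomial_functions"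
| mult: "f \<in> polynomial_functions \<Longrightarrow> g \<in> polynomial_functions \<Longrightarrow>
    (\<lambda>x. f x * g x) \<in> polynomial_functions"

definition zero_locus :: "(('n::finite \<Rightarrow> 'k::field) \<Rightarrow> 'k) set \<Rightarrow> ('n \<Rightarrow> 'k) set" where
  "zero_locus S = {x. \<forall>f\<in>S. f x = 0}"

definition zariski :: "('n::finite \<Rightarrow> 'k::field) topology" where
  "zariski = topology (\<lambda>U. \<exists>S\<subseteq>polynomial_functions. U = - zero_locus S)"

lemma istopology_zariski:
  "istopology (\<lambda>U :: ('n::finite \<Rightarrow> 'k::field) set. \<exists>S\<subseteq>polynomial_functions. U = - zero_locus S)"
  (is "istopology ?L")
  unfolding istopology_def
proof (intro conjI allI impI)
  fix A B :: "('n \<Rightarrow> 'k) set" assume "?L A" "?L B"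
  then obtain S T where S: "S \<subseteq> polynomial_functions" "A = - zero_locus S"
    and T: "T \<subseteq> polynomial_functions" "B = - zero_locus T" by blast
  let ?P = "(\<lambda>(f, g) x. f x * g x) ` (S \<times> T)"
  have "?P \<subseteq> polynomial_functions"
    using S(1) T(1) by (auto intro!: polynomial_functions.mult)
  moreover have "A \<inter> B = - zero_locus ?P"
    unfolding S(2) T(2) by (fastforce simp: zero_locus_def)
  ultimately show "?L (A \<inter> B)" by blast
next
  fix K :: "('n \<Rightarrow> 'k) set set" assume "\<forall>A\<in>K. ?L A"
  then obtain S where S: "\<And>A. A \<in> K \<Longrightarrow> S A \<subseteq> polynomial_functions \<and> A = - zero_locus (S A)"
    by metis
  have "\<Union>K = - zero_locus (\<Union>(S ` K))"
  proof (rule set_eqI)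
    fix x
    have "x \<in> A \<longleftrightarrow> (\<exists>f\<in>S A. f x \<noteq> 0)" if "A \<in> K" for A
    proof -
      have "x \<in> A \<longleftrightarrow> x \<in> - zero_locus (S A)" using S[OF that] by simp
      then show ?thesis by (simp add: zero_locus_def)
    qed
    then show "x \<in> \<Union>K \<longleftrightarrow> x \<in> - zero_locus (\<Union>(S ` K))"
      by (auto simp: zero_locus_def)
  qed
  moreover have "\<Union>(S ` K) \<subseteq> polynomial_functions" using S by blast
  ultimately show "?L (\<Union>K)" by blast
qed

lemma closedin_zariski:
  "closedin zariski X \<longleftrightarrow> (\<exists>S\<subseteq>polynomial_functions. X = zero_locus S)"
proof -
  have o: "openin zariski U \<longleftrightarrow> (\<exists>S\<subseteq>polynomial_functions. U = - zero_locus S)"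
    for U :: "('a \<Rightarrow> 'b) set"
    unfolding zariski_def by (subst topology_inverse'[OF istopology_zariski]) (rule refl)
  have "openin zariski (UNIV :: ('a \<Rightarrow> 'b) set)"
    unfolding o by (rule exI[of _ "{\<lambda>_. 1}"]) (auto simp: zero_locus_def intro: polynomial_functions.const)
  then have "topspace zariski = (UNIV :: ('a \<Rightarrow> 'b) set)"
    using openin_subset by blast
  then show ?thesis by (auto simp: closedin_def o Compl_eq_Diff_UNIV[symmetric])
qed

definition zariski_irreducible :: "('n::finite \<Rightarrow> 'k::field) set \<Rightarrow> bool" where
  "zariski_irreducible X \<longleftrightarrow> X \<noteq> {} \<and>
    (\<forall>A B. closedin zariski A \<longrightarrow> closedin zariski B \<longrightarrow> X \<subseteq> A \<union> B \<longrightarrow> X \<subseteq> A \<or> X \<subseteq> B)"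

definition irreducible_affine_variety :: "('n::finite \<Rightarrow> 'k::field) set \<Rightarrow> bool" where
  "irreducible_affine_variety X \<longleftrightarrow> closedin zariski X \<and> zariski_irreducible X"

definition krull_dim :: "('n::finite \<Rightarrow> 'k::field) set \<Rightarrow> enat" where
  "krull_dim X = (SUP d \<in> {d. \<exists>Z. (\<forall>i\<le>d. irreducible_affine_variety (Z i) \<and> Z i \<subseteq> X) \<and>
    (\<forall>i<d. Z i \<subset> Z (Suc i))}. enat d)"

text \<open>Functions on \<open>X\<close> are extended by \<open>0\<close> outside \<open>X\<close>, so that equality of functions on \<open>X\<close>
  is equality in HOL; the unit of \<open>k[X]\<close> is the indicator function of \<open>X\<close>.\<close>

definition coordinate_ring :: "('n::finite \<Rightarrow> 'k::field) set \<Rightarrow> (('n \<Rightarrow> 'k) \<Rightarrow> 'k) set" where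
  "coordinate_ring X = (\<lambda>p x. if x \<in> X then p x else 0) ` polynomial_functions"

definition morphism ::
    "('n::finite \<Rightarrow> 'k::field) set \<Rightarrow> ('m::finite \<Rightarrow> 'k) set \<Rightarrow> (('n \<Rightarrow> 'k) \<Rightarrow> ('m \<Rightarrow> 'k)) \<Rightarrow> bool" where
  "morphism X Y u \<longleftrightarrow> u ` X \<subseteq> Y \<and> (\<forall>i. \<exists>p\<in>polynomial_functions. \<forall>x\<in>X. u x i = p x)"

definition dominant_morphism ::
    "('n::finite \<Rightarrow> 'k::field) set \<Rightarrow> ('m::finite \<Rightarrow> 'k) set \<Rightarrow> (('n \<Rightarrow> 'k) \<Rightarrow> ('m \<Rightarrow> 'k)) \<Rightarrow> bool" where
  "dominant_morphism X Y u \<longleftrightarrow> morphism X Y u \<and> zariski closure_of (u ` X) = Y"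

definition comorphism ::
    "('n::finite \<Rightarrow> 'k::field) set \<Rightarrow> (('n \<Rightarrow> 'k) \<Rightarrow> ('m::finite \<Rightarrow> 'k)) \<Rightarrow>
      (('m \<Rightarrow> 'k) \<Rightarrow> 'k) \<Rightarrow> ('n \<Rightarrow> 'k) \<Rightarrow> 'k" where
  "comorphism X u f = (\<lambda>x. if x \<in> X then f (u x) else 0)"

text \<open>\<open>k[X]\<close> is a finitely generated \<open>k[Y]\<close>-module.\<close>

definition finite_morphism ::
    "('n::finite \<Rightarrow> 'k::field) set \<Rightarrow> ('m::finite \<Rightarrow> 'k) set \<Rightarrow> (('n \<Rightarrow> 'k) \<Rightarrow> ('m \<Rightarrow> 'k)) \<Rightarrow> bool" where
  "finite_morphism X Y u \<longleftrightarrow> morphism X Y u \<and>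
    (\<exists>G. finite G \<and> G \<subseteq> coordinate_ring X \<and>
      (\<forall>f\<in>coordinate_ring X. \<exists>c. (\<forall>g\<in>G. c g \<in> coordinate_ring Y) \<and>
        f = (\<lambda>x. \<Sum>g\<in>G. comorphism X u (c g) x * g x)))"


section \<open>Function fields\<close>

text \<open>HOL has no type depending on the set \<open>X\<close>, so \<open>k(X)\<close> is an arbitrary field type \<open>'f\<close> that is
  a field of fractions of \<open>k[X]\<close> via an embedding \<open>j\<close>; this determines it up to unique
  isomorphism over \<open>k[X]\<close>.\<close>

definition function_field ::
    "('n::finite \<Rightarrow> 'k::field) set \<Rightarrow> ((('n \<Rightarrow> 'k) \<Rightarrow> 'k) \<Rightarrow> 'f::field) \<Rightarrow> bool" where
  "function_field X j \<longleftrightarrow>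
    (\<forall>f\<in>coordinate_ring X. \<forall>g\<in>coordinate_ring X.
      j (\<lambda>x. f x + g x) = j f + j g \<and> j (\<lambda>x. f x * g x) = j f * j g) \<and>
    j (\<lambda>x. if x \<in> X then 1 else 0) = 1 \<and>
    inj_on j (coordinate_ring X) \<and>
    (\<forall>a. \<exists>f\<in>coordinate_ring X. \<exists>g\<in>coordinate_ring X. j g \<noteq> 0 \<and> a = j f / j g)"

text \<open>The embedding of \<open>k(Y)\<close> into \<open>k(X)\<close> induced by a dominant morphism \<open>u\<close> from \<open>X\<close> to \<open>Y\<close>.\<close>

definition function_field_embedding ::
    "('n::finite \<Rightarrow> 'k::field) set \<Rightarrow> ((('n \<Rightarrow> 'k) \<Rightarrow> 'k) \<Rightarrow> 'e::field) \<Rightarrow>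
     ('m::finite \<Rightarrow> 'k) set \<Rightarrow> ((('m \<Rightarrow> 'k) \<Rightarrow> 'k) \<Rightarrow> 'f::field) \<Rightarrow>
     (('n \<Rightarrow> 'k) \<Rightarrow> ('m \<Rightarrow> 'k)) \<Rightarrow> 'f \<Rightarrow> 'e" where
  "function_field_embedding X jX Y jY u a = (THE b. \<exists>f\<in>coordinate_ring Y. \<exists>g\<in>coordinate_ring Y.
    jY g \<noteq> 0 \<and> a = jY f / jY g \<and> b = jX (comorphism X u f) / jX (comorphism X u g))"

definition normal_variety ::
    "('n::finite \<Rightarrow> 'k::field) set \<Rightarrow> ((('n \<Rightarrow> 'k) \<Rightarrow> 'k) \<Rightarrow> 'f::field) \<Rightarrow> bool" where
  "normal_variety X j \<longleftrightarrow>
    (\<forall>a. (\<exists>p. lead_coeff p = 1 \<and> (\<forall>i. coeff p i \<in> j ` coordinate_ring X) \<and> poly p a = 0) \<longrightarrow>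
      a \<in> j ` coordinate_ring X)"


section \<open>Field extensions\<close>

text \<open>An extension of fields is given by a field homomorphism \<open>\<sigma>\<close> from the base field \<open>'f\<close> to
  \<open>'e\<close>.\<close>

definition is_min_poly :: "('f::field \<Rightarrow> 'e::field) \<Rightarrow> 'e \<Rightarrow> 'f poly \<Rightarrow> bool" where
  "is_min_poly \<sigma> a p \<longleftrightarrow> lead_coeff p = 1 \<and> poly (map_poly \<sigma> p) a = 0 \<and>
    (\<forall>q. q \<noteq> 0 \<longrightarrow> poly (map_poly \<sigma> q) a = 0 \<longrightarrow> degree p \<le> degree q)"

definition separable_element :: "('f::field \<Rightarrow> 'e::field) \<Rightarrow> 'e \<Rightarrow> bool" where
  "separable_element \<sigma> a \<longleftrightarrow> (\<exists>p. is_min_poly \<sigma> a p \<and> coprime p (pderiv p))"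

definition separable_extension :: "('f::field \<Rightarrow> 'e::field) \<Rightarrow> bool" where
  "separable_extension \<sigma> \<longleftrightarrow> (\<forall>a. separable_element \<sigma> a)"

text \<open>Infinite degrees are \<open>0\<close>. The separable degree is the degree of the separable closure of
  the base field.\<close>

definition extension_degree :: "('f::field \<Rightarrow> 'e::field) \<Rightarrow> nat" where
  "extension_degree \<sigma> = vector_space.dim (\<lambda>c x. \<sigma> c * x) (UNIV :: 'e set)"

definition separable_degree :: "('f::field \<Rightarrow> 'e::field) \<Rightarrow> nat" where
  "separable_degree \<sigma> = vector_space.dim (\<lambda>c x. \<sigma> c * x) {a. separable_element \<sigma> a}"


section \<open>The associated variety\<close>

text \<open>\<open>Vh\<close>, \<open>u0\<close>, \<open>u1\<close> and \<open>jH\<close> stand for the variety \<open>V\<close>-hat, the morphisms \<open>u\<close>-hat-0 from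
  \<open>V\<close> to \<open>V\<close>-hat and \<open>u\<close>-hat-1 from \<open>V\<close>-hat to \<open>W\<close>, and the embedding of the coordinate ring of
  \<open>V\<close>-hat in its function field.\<close>

definition associated_variety ::
    "('a::finite \<Rightarrow> 'k::field) set \<Rightarrow> ((('a \<Rightarrow> 'k) \<Rightarrow> 'k) \<Rightarrow> 'v::field) \<Rightarrow>
     ('b::finite \<Rightarrow> 'k) set \<Rightarrow> ((('b \<Rightarrow> 'k) \<Rightarrow> 'k) \<Rightarrow> 'w::field) \<Rightarrow>
     (('a \<Rightarrow> 'k) \<Rightarrow> ('b \<Rightarrow> 'k)) \<Rightarrow>
     ('c::finite \<Rightarrow> 'k) set \<Rightarrow> ((('c \<Rightarrow> 'k) \<Rightarrow> 'k) \<Rightarrow> 'h::field) \<Rightarrow>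
     (('a \<Rightarrow> 'k) \<Rightarrow> ('c \<Rightarrow> 'k)) \<Rightarrow> (('c \<Rightarrow> 'k) \<Rightarrow> ('b \<Rightarrow> 'k)) \<Rightarrow> bool" where
  "associated_variety V jV W jW u Vh jH u0 u1 \<longleftrightarrow>
    irreducible_affine_variety Vh \<and> function_field Vh jH \<and>
    dominant_morphism V Vh u0 \<and> dominant_morphism Vh W u1 \<and>
    krull_dim Vh = krull_dim W \<and>
    (\<forall>x\<in>V. u x = u1 (u0 x)) \<and>
    separable_extension (function_field_embedding Vh jH W jW u1) \<and>
    extension_degree (function_field_embedding Vh jH W jW u1) =
      separable_degree (function_field_embedding V jV W jW u) \<and>
    finite_morphism V Vh u0 \<and> bij_betw u0 V Vh \<and>
    (\<forall>y\<in>W. ecard {x\<in>V. u x = y} = ecard {x\<in>Vh. u1 x = y}) \<and>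
    (finite_morphism V W u \<longleftrightarrow> finite_morphism Vh W u1)"


section \<open>The sets \<open>U\<^sub>m\<close>\<close>

text \<open>A polynomial over \<open>k[W]\<close> is a polynomial over the field \<open>'w\<close> whose coefficients lie in
  \<open>jW ` coordinate_ring W\<close>; they are evaluated at \<open>y\<close> as regular functions.\<close>

definition poly_at ::
    "('b::finite \<Rightarrow> 'k::field) set \<Rightarrow> ((('b \<Rightarrow> 'k) \<Rightarrow> 'k) \<Rightarrow> 'w::field) \<Rightarrow>
      'w poly \<Rightarrow> ('b \<Rightarrow> 'k) \<Rightarrow> 'k poly" where
  "poly_at W jW F y = map_poly (\<lambda>a. inv_into (coordinate_ring W) jW a y) F"

definition Root ::
    "('b::finite \<Rightarrow> 'k::field) set \<Rightarrow> ((('b \<Rightarrow> 'k) \<Rightarrow> 'k) \<Rightarrow> 'w::field) \<Rightarrow>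
      'w poly \<Rightarrow> ('b \<Rightarrow> 'k) \<Rightarrow> 'k set" where
  "Root W jW F y = {z. poly (poly_at W jW F y) z = 0}"

definition U_poly ::
    "('b::finite \<Rightarrow> 'k::field) set \<Rightarrow> ((('b \<Rightarrow> 'k) \<Rightarrow> 'k) \<Rightarrow> 'w::field) \<Rightarrow>
      nat \<Rightarrow> 'w poly \<Rightarrow> ('b \<Rightarrow> 'k) set" where
  "U_poly W jW m F = {y\<in>W. enat m \<le> ecard (Root W jW F y)}"

definition min_polys ::
    "('b::finite \<Rightarrow> 'k::field) set \<Rightarrow> ((('b \<Rightarrow> 'k) \<Rightarrow> 'k) \<Rightarrow> 'w::field) \<Rightarrow>
     ('c::finite \<Rightarrow> 'k) set \<Rightarrow> ((('c \<Rightarrow> 'k) \<Rightarrow> 'k) \<Rightarrow> 'h::field) \<Rightarrow>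
     (('c \<Rightarrow> 'k) \<Rightarrow> ('b \<Rightarrow> 'k)) \<Rightarrow> nat \<Rightarrow> 'w poly set" where
  "min_polys W jW Vh jH u1 n = {P. degree P = n \<and>
    (\<exists>f\<in>coordinate_ring Vh. is_min_poly (function_field_embedding Vh jH W jW u1) (jH f) P)}"

definition U_morphism ::
    "('b::finite \<Rightarrow> 'k::field) set \<Rightarrow> ((('b \<Rightarrow> 'k) \<Rightarrow> 'k) \<Rightarrow> 'w::field) \<Rightarrow>
     ('c::finite \<Rightarrow> 'k) set \<Rightarrow> ((('c \<Rightarrow> 'k) \<Rightarrow> 'k) \<Rightarrow> 'h::field) \<Rightarrow>
     (('c \<Rightarrow> 'k) \<Rightarrow> ('b \<Rightarrow> 'k)) \<Rightarrow> nat \<Rightarrow> nat \<Rightarrow> ('b \<Rightarrow> 'k) set" where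
  "U_morphism W jW Vh jH u1 n m = (\<Union>P\<in>min_polys W jW Vh jH u1 n. U_poly W jW m P)"

end

theory Submission
  imports "HOL-Algebra.Algebraic_Closure_Type" Defs
begin

text \<open>
  The fibres of \<open>u\<close> and of the separable morphism \<open>u1\<close> from \<open>V\<close>-hat to \<open>W\<close> have the same number of points,
  so only \<open>u1\<close> matters. Write \<open>A = k[W]\<close> and \<open>B\<close> for the coordinate ring of \<open>V\<close>-hat: \<open>B\<close> is a finite \<open>A\<close>-module,
  and the fraction field of \<open>B\<close> is separable of degree \<open>n\<close> over that of \<open>A\<close>. Since \<open>A\<close> is integrally
  closed, the minimal polynomial \<open>P\<close> of any \<open>t \<in> B\<close> has coefficients in \<open>A\<close>
  (\<open>min_poly_over_R\<close>), so that it can be specialised at a point \<open>y\<close> of \<open>W\<close>.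

  The theorem rests on two facts. First, the roots of \<open>P(y, T)\<close> are exactly the values of \<open>t\<close> on
  the fibre over \<open>y\<close> (\<open>root_at_point\<close> and \<open>point_over_root\<close>). That values are roots is evaluation of
  \<open>P(t) = 0\<close>; that every root occurs is lying over for the finite extension of \<open>A[t]\<close> by \<open>B\<close>,
  combined with the Nullstellensatz. Hence \<open>P(y, T)\<close> never has more roots than the fibre has points.
  Second, given finitely many points of a fibre, there is a \<open>t\<close> which is a primitive element and
  takes distinct values at these points (\<open>primitive_separating_function\<close>): a linear combination of
  the coordinates whose coefficients avoid finitely many values. Its minimal polynomial has
  degree \<open>n\<close>, and its specialisation has at least as many roots as there are given points.

  The two facts together describe the points whose fibre has at least \<open>m\<close> elements. The second one
  also bounds the size of a fibre, because \<open>P(y, T)\<close> has degree \<open>n\<close>; the points whose fibre has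
  exactly \<open>n\<close> elements are then those where it has at least \<open>n\<close>.

  Integrality, lying over and the Nullstellensatz all come from Nakayama's lemma inside a field
  (\<open>field_nakayama\<close>) and the factorisation of polynomials over \<open>k\<close>
  (\<open>proper_ideal_with_residues\<close>).
\<close>

section \<open>Polynomials over a subring\<close>

text \<open>Subrings are sets inside an ambient ring type, so that the coordinate rings of several
  varieties, and the rings between them, can be compared inside one function field. Closure under
  subtraction makes a subring contain \<open>0\<close> and negatives.\<close>

definition unital_subring :: "'a::comm_ring_1 set \<Rightarrow> bool" where
  "unital_subring R \<longleftrightarrow> 1 \<in> R \<and> (\<forall>x\<in>R. \<forall>y\<in>R. x - y \<in> R \<and> x * y \<in> R)"

text \<open>The polynomials with coefficients in \<open>R\<close>, as a predicate on polynomials over the ambient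
  ring.\<close>

definition poly_over :: "'a::comm_ring_1 set \<Rightarrow> 'a poly \<Rightarrow> bool" where
  "poly_over R p \<longleftrightarrow> (\<forall>i. coeff p i \<in> R)"

text \<open>A ring homomorphism that is only required to respect the operations on \<open>R\<close>. This covers
  evaluation at a point, which is meaningful on the coordinate ring but not on the whole function
  field.\<close>

definition ring_hom_on :: "'a::comm_ring_1 set \<Rightarrow> ('a \<Rightarrow> 'b::comm_ring_1) \<Rightarrow> bool" where
  "ring_hom_on R f \<longleftrightarrow> f 1 = 1 \<and> (\<forall>x\<in>R. \<forall>y\<in>R. f (x + y) = f x + f y \<and> f (x * y) = f x * f y)"

context
  fixes R :: "'a::comm_ring_1 set"
  assumes R: "unital_subring R"
begin

lemma subring_one: "1 \<in> R" and subring_diff: "x \<in> R \<Longrightarrow> y \<in> R \<Longrightarrow> x - y \<in> R"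
  and subring_mult: "x \<in> R \<Longrightarrow> y \<in> R \<Longrightarrow> x * y \<in> R"
  using R by (auto simp: unital_subring_def)

lemma subring_zero: "0 \<in> R"
  using subring_diff[OF subring_one subring_one] by simp

lemma subring_uminus: "x \<in> R \<Longrightarrow> - x \<in> R"
  using subring_diff[OF subring_zero] by simp

lemma subring_add: "x \<in> R \<Longrightarrow> y \<in> R \<Longrightarrow> x + y \<in> R"
  using subring_diff[of x "- y"] subring_uminus by simp

lemma subring_power: "x \<in> R \<Longrightarrow> x ^ n \<in> R"
  by (induction n) (auto intro: subring_one subring_mult)

lemma subring_sum: "(\<And>i. i \<in> I \<Longrightarrow> f i \<in> R) \<Longrightarrow> sum f I \<in> R"
  by (induction I rule: infinite_finite_induct) (auto intro: subring_zero subring_add)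

lemma poly_over_one: "poly_over R 1"
  unfolding poly_over_def one_pCons by (auto simp: coeff_pCons subring_zero subring_one split: nat.splits)

lemma poly_over_zero: "poly_over R 0"
  by (simp add: poly_over_def subring_zero)

lemma poly_over_monom: "c \<in> R \<Longrightarrow> poly_over R (monom c i)"
  by (simp add: poly_over_def subring_zero)

lemma poly_over_pCons: "c \<in> R \<Longrightarrow> poly_over R p \<Longrightarrow> poly_over R (pCons c p)"
  by (auto simp: poly_over_def coeff_pCons split: nat.splits)

lemma poly_over_add: "poly_over R p \<Longrightarrow> poly_over R q \<Longrightarrow> poly_over R (p + q)"
  and poly_over_diff: "poly_over R p \<Longrightarrow> poly_over R q \<Longrightarrow> poly_over R (p - q)"
  by (auto simp: poly_over_def subring_add subring_diff)

lemma poly_over_mult: "poly_over R p \<Longrightarrow> poly_over R q \<Longrightarrow> poly_over R (p * q)"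
  by (auto simp: poly_over_def coeff_mult intro: subring_sum subring_mult)

lemma poly_over_sum: "(\<And>i. i \<in> I \<Longrightarrow> poly_over R (f i)) \<Longrightarrow> poly_over R (sum f I)"
  by (auto simp: poly_over_def coeff_sum intro: subring_sum)

lemma poly_over_pcompose: "poly_over R p \<Longrightarrow> poly_over R q \<Longrightarrow> poly_over R (pcompose p q)"
proof (induction p)
  case (pCons a p)
  have "a \<in> R" using pCons.prems(1) by (metis poly_over_def coeff_pCons_0)
  moreover have "poly_over R p" using pCons.prems(1) by (metis poly_over_def coeff_pCons_Suc)
  ultimately show ?case using pCons
    by (auto simp: pcompose_pCons intro!: poly_over_add poly_over_mult poly_over_pCons poly_over_zero)
qed simp

lemma poly_in_subring: "poly_over R p \<Longrightarrow> x \<in> R \<Longrightarrow> poly p x \<in> R"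
  unfolding poly_altdef by (auto simp: poly_over_def intro!: subring_sum subring_mult subring_power)

lemma monic_division_over:
  assumes "lead_coeff h = 1" "poly_over R h" "poly_over R p"
  shows "\<exists>q r. poly_over R q \<and> poly_over R r \<and> p = h * q + r \<and> (r = 0 \<or> degree r < degree h)"
  using assms(3)
proof (induction "degree p" arbitrary: p rule: less_induct)
  case less
  show ?case
  proof (cases "p = 0 \<or> degree p < degree h")
    case True
    then show ?thesis using less.prems by (intro exI[of _ 0] exI[of _ p]) (auto simp: poly_over_zero)
  next
    case False
    define m where "m = monom (lead_coeff p) (degree p - degree h)"
    define p' where "p' = p - h * m"
    have m: "poly_over R m" using less.prems by (auto simp: m_def poly_over_def intro!: subring_zero)
    have deg: "degree p = degree h + degree m" using False by (simp add: m_def degree_monom_eq)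
    have "lead_coeff m = lead_coeff p" using False by (simp add: m_def degree_monom_eq)
    then have "coeff p' (degree p) = 0"
      using assms(1) coeff_mult_degree_sum[of h m] by (simp add: p'_def deg)
    moreover have "degree p' \<le> degree p"
      unfolding p'_def using degree_mult_le[of h m] by (intro degree_diff_le) (auto simp: deg)
    ultimately have *: "p' = 0 \<or> degree p' < degree p"
      by (metis leading_coeff_0_iff order_le_less)
    have p': "poly_over R p'" unfolding p'_def by (intro poly_over_diff poly_over_mult less.prems assms(2) m)
    have p: "p = h * m + p'" by (simp add: p'_def)
    from * show ?thesis
    proof
      assume "p' = 0"
      then show ?thesis using m p by (intro exI[of _ m] exI[of _ 0]) (auto simp: poly_over_zero)
    next
      assume "degree p' < degree p"
      from less.hyps[OF this p'] obtain q r where qr: "poly_over R q" "poly_over R r" "p' = h * q + r"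
        "r = 0 \<or> degree r < degree h" by blast
      then show ?thesis using p m
        by (intro exI[of _ "m + q"] exI[of _ r]) (simp add: distrib_left add.assoc poly_over_add)
    qed
  qed
qed

end

lemma unital_subring_UNIV: "unital_subring UNIV"
  by (simp add: unital_subring_def)

lemma poly_over_UNIV: "poly_over UNIV p"
  by (simp add: poly_over_def)

lemma poly_over_mono: "poly_over R p \<Longrightarrow> R \<subseteq> S \<Longrightarrow> poly_over S p"
  by (auto simp: poly_over_def)

context
  fixes R :: "'a::comm_ring_1 set" and f :: "'a \<Rightarrow> 'b::comm_ring_1"
  assumes R: "unital_subring R" and f: "ring_hom_on R f"
begin

lemma hom_one: "f 1 = 1" and hom_add: "x \<in> R \<Longrightarrow> y \<in> R \<Longrightarrow> f (x + y) = f x + f y"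
  and hom_mult: "x \<in> R \<Longrightarrow> y \<in> R \<Longrightarrow> f (x * y) = f x * f y"
  using f by (auto simp: ring_hom_on_def)

lemma hom_zero: "f 0 = 0"
  using hom_add[OF subring_zero[OF R] subring_zero[OF R]] by simp

lemma hom_diff: "x \<in> R \<Longrightarrow> y \<in> R \<Longrightarrow> f (x - y) = f x - f y"
  using hom_add[of "x - y" y] subring_diff[OF R] by simp

lemma hom_uminus: "x \<in> R \<Longrightarrow> f (- x) = - f x"
  using hom_diff[OF subring_zero[OF R], of x] by (simp add: hom_zero)

lemma hom_sum: "(\<And>i. i \<in> I \<Longrightarrow> g i \<in> R) \<Longrightarrow> f (sum g I) = (\<Sum>i\<in>I. f (g i))"
  by (induction I rule: infinite_finite_induct) (auto simp: hom_zero hom_add subring_sum[OF R])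

lemma hom_image_subring: "unital_subring (f ` R)"
  unfolding unital_subring_def
  using imageI[OF subring_one[OF R], of f]
  by (auto simp: hom_one simp flip: hom_diff hom_mult intro!: imageI subring_diff[OF R] subring_mult[OF R])

lemma map_poly_add_on:
  "poly_over R p \<Longrightarrow> poly_over R q \<Longrightarrow> map_poly f (p + q) = map_poly f p + map_poly f q"
  by (intro poly_eqI) (auto simp: coeff_map_poly hom_zero hom_add poly_over_def)

lemma map_poly_diff_on:
  "poly_over R p \<Longrightarrow> poly_over R q \<Longrightarrow> map_poly f (p - q) = map_poly f p - map_poly f q"
  by (intro poly_eqI) (auto simp: coeff_map_poly hom_zero hom_diff poly_over_def)

lemma map_poly_mult_on:
  assumes "poly_over R p" "poly_over R q"
  shows "map_poly f (p * q) = map_poly f p * map_poly f q"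
proof (rule poly_eqI)
  fix n
  have "f (\<Sum>i\<le>n. coeff p i * coeff q (n - i)) = (\<Sum>i\<le>n. f (coeff p i * coeff q (n - i)))"
    using assms by (intro hom_sum) (auto simp: poly_over_def subring_mult[OF R])
  also have "\<dots> = (\<Sum>i\<le>n. f (coeff p i) * f (coeff q (n - i)))"
    using assms by (intro sum.cong) (auto simp: poly_over_def hom_mult)
  finally show "coeff (map_poly f (p * q)) n = coeff (map_poly f p * map_poly f q) n"
    by (simp add: coeff_map_poly hom_zero coeff_mult)
qed

lemma poly_map_poly_on:
  assumes "poly_over R p" "x \<in> R"
  shows "poly (map_poly f p) (f x) = f (poly p x)"
  using assms(1)
proof (induction p)
  case (pCons a p)
  have "a \<in> R" using pCons.prems(1) by (metis poly_over_def coeff_pCons_0)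
  moreover have p: "poly_over R p" using pCons.prems(1) by (metis poly_over_def coeff_pCons_Suc)
  moreover have "poly p x \<in> R" by (rule poly_in_subring[OF R p assms(2)])
  ultimately show ?case using pCons(2) assms(2)
    by (simp add: map_poly_pCons hom_zero hom_add hom_mult subring_mult[OF R])
qed (simp add: hom_zero)

lemma poly_over_map_poly: "poly_over R p \<Longrightarrow> poly_over (f ` R) (map_poly f p)"
  by (auto simp: poly_over_def coeff_map_poly hom_zero)

lemma lead_coeff_map_poly_monic:
  "lead_coeff p = 1 \<Longrightarrow> (1 :: 'b) \<noteq> 0 \<Longrightarrow> lead_coeff (map_poly f p) = 1 \<and> degree (map_poly f p) = degree p"
  using map_poly_degree_eq[of f p] hom_zero hom_one by (simp add: coeff_map_poly)

end

lemma poly_over_image_lift: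
  assumes "poly_over (f ` R) p" "f 0 = 0" "0 \<in> R"
  shows "\<exists>q. poly_over R q \<and> map_poly f q = p \<and> degree q \<le> degree p"
proof -
  have "\<forall>i. \<exists>a. a \<in> R \<and> f a = coeff p i" using assms(1) unfolding poly_over_def by (metis imageE)
  then obtain a where a: "\<And>i. a i \<in> R" "\<And>i. f (a i) = coeff p i" by metis
  define q where "q = (\<Sum>i\<le>degree p. monom (a i) i)"
  have c: "coeff q i = (if i \<le> degree p then a i else 0)" for i
    unfolding q_def coeff_sum by simp
  have "map_poly f q = p"
    by (intro poly_eqI) (auto simp: coeff_map_poly assms(2) c a coeff_eq_0)
  moreover have "degree q \<le> degree p" by (rule degree_le) (simp add: c)
  moreover have "poly_over R q" using a assms(3) by (simp add: poly_over_def c)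
  ultimately show ?thesis by blast
qed

section \<open>Integral elements\<close>

text \<open>The set \<open>q\<close> is an ideal of the subring \<open>R\<close>, not of the ambient ring. It need not be proper.\<close>

definition is_ideal :: "'a::comm_ring_1 set \<Rightarrow> 'a set \<Rightarrow> bool" where
  "is_ideal R q \<longleftrightarrow> q \<subseteq> R \<and> 0 \<in> q \<and> (\<forall>a\<in>q. \<forall>b\<in>q. a + b \<in> q) \<and> (\<forall>r\<in>R. \<forall>a\<in>q. r * a \<in> q)"

text \<open>Nakayama's lemma for a finitely generated module inside a field: if the module is contained in
  \<open>q\<close> times itself and \<open>q\<close> is proper, then it is zero. Instead of a determinant, the proof eliminates
  one generator at a time: the relation for \<open>g r\<close> has the coefficient \<open>1 - M r r\<close>, which is nonzero
  because \<open>M r r \<in> q\<close>.\<close>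

lemma field_nakayama:
  fixes g :: "'i \<Rightarrow> 'a::field"
  assumes R: "unital_subring R" and q: "is_ideal R q" and "1 \<notin> q"
    and "finite I" and "\<And>i j. i \<in> I \<Longrightarrow> j \<in> I \<Longrightarrow> M i j \<in> q"
    and "\<And>i. i \<in> I \<Longrightarrow> g i = (\<Sum>j\<in>I. M i j * g j)"
  shows "\<forall>i\<in>I. g i = 0"
  using assms(4-)
proof (induction I arbitrary: M rule: finite_induct)
  case (insert r I)
  have qR: "\<And>a. a \<in> q \<Longrightarrow> a \<in> R" and qadd: "\<And>a b. a \<in> q \<Longrightarrow> b \<in> q \<Longrightarrow> a + b \<in> q"
    and qmult: "\<And>a b. a \<in> R \<Longrightarrow> b \<in> q \<Longrightarrow> a * b \<in> q" and q0: "0 \<in> q"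
    using q by (auto simp: is_ideal_def)
  define d where "d = 1 - M r r"
  have "M r r \<in> q" using insert.prems by blast
  then have d0: "d \<noteq> 0" and dR: "d \<in> R"
    using \<open>1 \<notin> q\<close> qR subring_diff[OF R subring_one[OF R]] by (auto simp: d_def)
  have "g r = M r r * g r + (\<Sum>j\<in>I. M r j * g j)"
    using insert.prems(2)[of r] insert.hyps by simp
  then have r: "d * g r = (\<Sum>j\<in>I. M r j * g j)"
    by (simp add: d_def algebra_simps)
  define N where "N = (\<lambda>i j. d * M i j + M i r * M r j + (if i = j then M r r else 0))"
  \<comment> \<open>Multiply the relation for \<open>g i\<close> by \<open>d = 1 - M r r\<close>, substitute the one for \<open>d * g r\<close>, and move
    \<open>M r r * g i\<close> back to the right. The new coefficients \<open>N i j\<close> lie in \<open>q\<close> again.\<close>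
  have "g i = (\<Sum>j\<in>I. N i j * g j)" if i: "i \<in> I" for i
  proof -
    have "g i = M i r * g r + (\<Sum>j\<in>I. M i j * g j)"
      using insert.prems(2)[of i] insert.hyps i by simp
    then have "d * g i = M i r * (d * g r) + d * (\<Sum>j\<in>I. M i j * g j)"
      by (metis (no_types, lifting) distrib_left mult.left_commute)
    also have "\<dots> = (\<Sum>j\<in>I. (d * M i j + M i r * M r j) * g j)"
      unfolding r by (simp add: sum_distrib_left sum.distrib algebra_simps)
    finally have "g i = (\<Sum>j\<in>I. (d * M i j + M i r * M r j) * g j) + M r r * g i"
      by (simp add: d_def algebra_simps)
    also have "M r r * g i = (\<Sum>j\<in>I. (if i = j then M r r else 0) * g j)"
      using i insert.hyps by (simp add: if_distrib[of "\<lambda>x. x * _"] sum.delta' cong: if_cong)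
    finally show ?thesis by (simp add: N_def sum.distrib distrib_right)
  qed
  moreover have "N i j \<in> q" if "i \<in> I" "j \<in> I" for i j
    using insert.prems(1) that dR qR q0 unfolding N_def by (auto intro!: qadd qmult)
  ultimately have *: "\<forall>i\<in>I. g i = 0" by (intro insert.IH) auto
  then have "d * g r = 0" using r by simp
  then show ?case using * d0 by simp
qed simp

text \<open>All combinations of the family \<open>g\<close> with coefficients in \<open>R\<close>. For a subring \<open>R\<close> this is the
  submodule generated by \<open>g\<close>; for an ideal \<open>R\<close> and generators \<open>g\<close> of a larger ring it is the extended
  ideal.\<close>

definition lincomb :: "'a::comm_ring_1 set \<Rightarrow> 'i set \<Rightarrow> ('i \<Rightarrow> 'a) \<Rightarrow> 'a set" where
  "lincomb R I g = {\<Sum>i\<in>I. a i * g i | a. \<forall>i\<in>I. a i \<in> R}"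

lemma lincomb_add:
  assumes "unital_subring R" "x \<in> lincomb R I g" "y \<in> lincomb R I g"
  shows "x + y \<in> lincomb R I g"
proof -
  obtain a b where "\<forall>i\<in>I. a i \<in> R" "\<forall>i\<in>I. b i \<in> R" "x = (\<Sum>i\<in>I. a i * g i)" "y = (\<Sum>i\<in>I. b i * g i)"
    using assms(2,3) by (auto simp: lincomb_def)
  then show ?thesis using subring_add[OF assms(1)]
    unfolding lincomb_def by (intro CollectI exI[of _ "\<lambda>i. a i + b i"]) (auto simp: distrib_right sum.distrib)
qed

lemma lincomb_scale:
  assumes "unital_subring R" "x \<in> lincomb R I g" "c \<in> R"
  shows "c * x \<in> lincomb R I g"
proof -
  obtain a where "\<forall>i\<in>I. a i \<in> R" "x = (\<Sum>i\<in>I. a i * g i)"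
    using assms(2) by (auto simp: lincomb_def)
  then show ?thesis using subring_mult[OF assms(1)] assms(3)
    unfolding lincomb_def by (intro CollectI exI[of _ "\<lambda>i. c * a i"]) (auto simp: sum_distrib_left mult.assoc)
qed

lemma lincomb_zero: "unital_subring R \<Longrightarrow> 0 \<in> lincomb R I g"
  unfolding lincomb_def by (intro CollectI exI[of _ "\<lambda>_. 0"]) (auto simp: subring_zero)

lemma lincomb_sum:
  "unital_subring R \<Longrightarrow> (\<And>j. j \<in> J \<Longrightarrow> f j \<in> lincomb R I g) \<Longrightarrow> sum f J \<in> lincomb R I g"
  by (induction J rule: infinite_finite_induct) (auto intro: lincomb_zero lincomb_add)

lemma lincomb_generator:
  assumes "unital_subring R" "finite I" "i \<in> I"
  shows "g i \<in> lincomb R I g"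
proof -
  have "g i = (\<Sum>j\<in>I. (if j = i then 1 else 0) * g j)"
    using assms by (simp add: if_distrib[of "\<lambda>x. x * _"] cong: if_cong)
  then show ?thesis using assms(1) unfolding lincomb_def
    by (intro CollectI exI[of _ "\<lambda>j. if j = i then 1 else 0"]) (auto simp: subring_one subring_zero)
qed

text \<open>Integrality over a subring: \<open>x\<close> is a root of a monic polynomial with coefficients in \<open>R\<close>.\<close>

definition integral_over :: "'a::comm_ring_1 set \<Rightarrow> 'a \<Rightarrow> bool" where
  "integral_over R x \<longleftrightarrow> (\<exists>p. lead_coeff p = 1 \<and> poly_over R p \<and> poly p x = 0)"

lemma integral_over_if_power:
  assumes R: "unital_subring R" and "\<And>i. i < N \<Longrightarrow> a i \<in> R" and "x ^ N = (\<Sum>i<N. a i * x ^ i)"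
  shows "integral_over R x"
proof -
  define s where "s = (\<Sum>i<N. monom (a i) i)"
  define p where "p = monom 1 N - s"
  have c: "coeff s i = (if i < N then a i else 0)" for i
    unfolding s_def coeff_sum by simp
  have "coeff p N = 1" "\<And>i. i > N \<Longrightarrow> coeff p i = 0"
    by (auto simp: p_def c)
  moreover from this have "degree p = N"
    by (intro antisym degree_le le_degree) auto
  ultimately have "lead_coeff p = 1" by simp
  moreover have "poly_over R p"
    unfolding p_def s_def using assms(2)
    by (intro poly_over_diff poly_over_sum poly_over_monom R subring_one[OF R]) auto
  moreover have "poly p x = 0"
    using assms(3) by (simp add: p_def s_def poly_sum poly_monom)
  ultimately show ?thesis unfolding integral_over_def by blast
qed

lemma integral_over_imp_power:
  assumes R: "unital_subring R" and "integral_over R x"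
  shows "\<exists>N a. (\<forall>i<N. a i \<in> R) \<and> x ^ N = (\<Sum>i<N. a i * x ^ i)"
proof -
  obtain p where p: "lead_coeff p = 1" "poly_over R p" "poly p x = 0"
    using assms(2) by (auto simp: integral_over_def)
  have "poly p x = (\<Sum>i<degree p. coeff p i * x ^ i) + x ^ degree p"
    using p(1) by (simp add: poly_altdef lessThan_Suc_atMost[symmetric])
  then have "x ^ degree p = (\<Sum>i<degree p. - coeff p i * x ^ i)"
    using p(3) by (simp add: sum_negf eq_neg_iff_add_eq_0 add.commute)
  moreover have "\<forall>i. - coeff p i \<in> R"
    using p(2) subring_uminus[OF R] by (auto simp: poly_over_def)
  ultimately show ?thesis by (intro exI[of _ "degree p"] exI[of _ "\<lambda>i. - coeff p i"]) simp
qed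

text \<open>Multiplication by \<open>c\<close> maps a nonzero finitely generated module into itself only if \<open>c\<close> is
  integral. With \<open>s = 1 / c\<close>, the module is contained in \<open>s R[s]\<close> times itself, so \<open>field_nakayama\<close> gives
  \<open>1 \<in> s R[s]\<close>. Multiplying this relation by a power of \<open>c\<close> yields a monic equation for \<open>c\<close>.\<close>

lemma integral_over_if_stable_module:
  fixes g :: "'i \<Rightarrow> 'a::field"
  assumes R: "unital_subring R" and I: "finite I" and g: "\<exists>i\<in>I. g i \<noteq> 0"
    and stable: "\<And>i. i \<in> I \<Longrightarrow> c * g i \<in> lincomb R I g"
  shows "integral_over R c"
proof (cases "c = 0")
  case True
  have "poly_over R [:0, 1:]"
    by (intro poly_over_pCons poly_over_zero subring_zero subring_one R)
  then show ?thesis using True unfolding integral_over_def by (intro exI[of _ "[:0, 1:]"]) simp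
next
  case False
  define s where "s = inverse c"
  define S where "S = {poly p s | p. poly_over R p}"
  have S: "unital_subring S"
    unfolding unital_subring_def
  proof (intro conjI ballI)
    show "1 \<in> S" unfolding S_def using poly_over_one[OF R] by (intro CollectI exI[of _ 1]) simp
    fix x y assume "x \<in> S" "y \<in> S"
    then obtain p q where "x = poly p s" "poly_over R p" "y = poly q s" "poly_over R q"
      by (auto simp: S_def)
    then have "x - y = poly (p - q) s" "poly_over R (p - q)" "x * y = poly (p * q) s" "poly_over R (p * q)"
      using poly_over_diff[OF R] poly_over_mult[OF R] by auto
    then show "x - y \<in> S" "x * y \<in> S" unfolding S_def by blast+
  qed
  have RS: "a \<in> S" if "a \<in> R" for a
    unfolding S_def using that poly_over_pCons[OF R that poly_over_zero[OF R]]
    by (intro CollectI exI[of _ "[:a:]"]) auto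
  have sS: "s \<in> S"
    unfolding S_def using poly_over_monom[OF R subring_one[OF R], of 1]
    by (intro CollectI exI[of _ "monom 1 1"]) (auto simp: poly_monom)
  define q where "q = (\<lambda>x. s * x) ` S"
  have q: "is_ideal S q"
    unfolding is_ideal_def
  proof (intro conjI ballI)
    show "q \<subseteq> S" by (auto simp: q_def intro: subring_mult[OF S sS])
    show "0 \<in> q" unfolding q_def using imageI[OF subring_zero[OF S], of "\<lambda>x. s * x"] by simp
    fix b assume b: "b \<in> q"
    then obtain b' where b': "b' \<in> S" "b = s * b'" by (auto simp: q_def)
    show "a + b \<in> q" if "a \<in> q" for a
      using that b' by (auto simp: q_def simp flip: distrib_left intro: subring_add[OF S])
    show "a * b \<in> q" if "a \<in> S" for a
      unfolding q_def by (rule image_eqI[of _ _ "a * b'"]) (auto simp: b' that subring_mult[OF S])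
  qed
  have "\<forall>i\<in>I. \<exists>a. (\<forall>j\<in>I. a j \<in> R) \<and> c * g i = (\<Sum>j\<in>I. a j * g j)"
    using stable by (auto simp: lincomb_def)
  then obtain a where a: "\<And>i j. i \<in> I \<Longrightarrow> j \<in> I \<Longrightarrow> a i j \<in> R"
    "\<And>i. i \<in> I \<Longrightarrow> c * g i = (\<Sum>j\<in>I. a i j * g j)" by metis
  have "1 \<in> q"
  proof (rule ccontr)
    assume "1 \<notin> q"
    have "\<forall>i\<in>I. g i = 0"
    proof (rule field_nakayama[OF S q \<open>1 \<notin> q\<close> I, where M = "\<lambda>i j. s * a i j"])
      show "s * a i j \<in> q" if "i \<in> I" "j \<in> I" for i j
        using a(1)[OF that] RS by (auto simp: q_def)
      show "g i = (\<Sum>j\<in>I. s * a i j * g j)" if "i \<in> I" for i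
      proof -
        have "g i = s * (c * g i)" using False by (simp add: s_def)
        then show ?thesis by (simp add: a(2)[OF that] sum_distrib_left mult.assoc)
      qed
    qed
    then show False using g by blast
  qed
  then obtain p where p: "poly_over R p" "1 = s * poly p s"
    by (auto simp: q_def S_def)
  define N where "N = degree p"
  have "c ^ Suc N = c ^ Suc N * (s * poly p s)" using p(2) by simp
  also have "\<dots> = c ^ N * poly p s" using False by (simp add: s_def)
  also have "\<dots> = (\<Sum>i\<le>N. coeff p i * c ^ (N - i))"
  proof -
    have "c ^ N * s ^ i = c ^ (N - i)" if "i \<le> N" for i
    proof -
      have "c ^ N = c ^ (N - i) * c ^ i" using that by (simp flip: power_add)
      moreover have "c ^ i * s ^ i = 1" using False by (simp add: s_def flip: power_mult_distrib)
      ultimately show ?thesis by (simp add: mult.assoc)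
    qed
    then show ?thesis
      by (auto simp: poly_altdef N_def[symmetric] sum_distrib_left mult.left_commute[of "c ^ N"] intro!: sum.cong)
  qed
  also have "\<dots> = (\<Sum>i\<le>N. coeff p (N - i) * c ^ i)"
    by (rule sum.reindex_bij_witness[of _ "\<lambda>i. N - i" "\<lambda>i. N - i"]) auto
  finally have "c ^ Suc N = (\<Sum>i<Suc N. coeff p (N - i) * c ^ i)"
    by (simp only: lessThan_Suc_atMost)
  then show ?thesis
    using p(1) by (intro integral_over_if_power[OF R, of "Suc N" "\<lambda>i. coeff p (N - i)"]) (auto simp: poly_over_def)
qed

text \<open>For \<open>x\<close> and \<open>y\<close> integral of degrees \<open>M\<close> and \<open>N\<close>, the module generated by the monomials
  \<open>x ^ i * y ^ j\<close> with \<open>i < M\<close> and \<open>j < N\<close> is stable under multiplication by \<open>x + y\<close> and \<open>x * y\<close>.\<close>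

lemma unital_subring_integral_closure:
  assumes R: "unital_subring (R :: 'a::field set)"
  shows "unital_subring {x. integral_over R x}"
proof -
  have neg: "integral_over R (- y)" if y: "integral_over R y" for y
  proof -
    obtain N a where a: "\<forall>i<N. a i \<in> R" "y ^ N = (\<Sum>i<N. a i * y ^ i)"
      using integral_over_imp_power[OF R y] by blast
    have m: "(- 1) ^ i \<in> R" for i :: nat
      by (intro subring_power subring_uminus subring_one R)
    have "(- y) ^ N = (- 1) ^ N * y ^ N" by (rule power_minus)
    also have "\<dots> = (\<Sum>i<N. ((- 1) ^ N * (a i * (- 1) ^ i)) * (- y) ^ i)"
    proof -
      have "(- 1) ^ i * (- y) ^ i = y ^ i" for i by (simp flip: power_mult_distrib)
      then show ?thesis by (simp add: a(2) sum_distrib_left mult.assoc)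
    qed
    finally show ?thesis
      by (intro integral_over_if_power[OF R]) (auto intro!: subring_mult R m a(1)[rule_format])
  qed
  have both: "integral_over R (x + y) \<and> integral_over R (x * y)"
    if x: "integral_over R x" and y: "integral_over R y" for x y
  proof -
    obtain M a where a: "\<forall>i<M. a i \<in> R" "x ^ M = (\<Sum>i<M. a i * x ^ i)"
      using integral_over_imp_power[OF R x] by blast
    obtain N b where b: "\<forall>i<N. b i \<in> R" "y ^ N = (\<Sum>i<N. b i * y ^ i)"
      using integral_over_imp_power[OF R y] by blast
    have M: "M > 0" using a(2) by (cases M) auto
    have N: "N > 0" using b(2) by (cases N) auto
    define I where "I = {..<M} \<times> {..<N}"
    define g where "g = (\<lambda>(i, j). x ^ i * y ^ j)"
    let ?L = "lincomb R I g"
    have fin: "finite I" by (simp add: I_def)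
    have gen: "x ^ i * y ^ j \<in> ?L" if "i < M" "j < N" for i j
      using lincomb_generator[OF R fin, of "(i, j)" g] that by (simp add: I_def g_def)
    have multx: "x * v \<in> ?L" if "v \<in> ?L" for v
    proof -
      obtain e where e: "\<forall>i\<in>I. e i \<in> R" "v = (\<Sum>i\<in>I. e i * g i)"
        using \<open>v \<in> ?L\<close> by (auto simp: lincomb_def)
      have "x * g k \<in> ?L" if "k \<in> I" for k
      proof -
        obtain i j where k: "k = (i, j)" "i < M" "j < N" using \<open>k \<in> I\<close> by (auto simp: I_def)
        show ?thesis
        proof (cases "Suc i < M")
          case True
          then show ?thesis using gen[of "Suc i" j] k by (simp add: g_def mult.assoc)
        next
          case False
          then have "Suc i = M" using k by simp
          then have "x * g k = (\<Sum>i<M. a i * (x ^ i * y ^ j))"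
            using a(2) k by (simp add: g_def sum_distrib_right mult.assoc[symmetric] flip: power_Suc)
          also have "\<dots> \<in> ?L"
            using a(1) k by (intro lincomb_sum[OF R], intro lincomb_scale[OF R gen]) simp_all
          finally show ?thesis .
        qed
      qed
      then have "(\<Sum>i\<in>I. e i * (x * g i)) \<in> ?L"
        using e(1) by (intro lincomb_sum[OF R], rule_tac lincomb_scale[OF R]) simp_all
      then show ?thesis by (simp add: e(2) sum_distrib_left mult.left_commute)
    qed
    have multy: "y * v \<in> ?L" if "v \<in> ?L" for v
    proof -
      obtain e where e: "\<forall>i\<in>I. e i \<in> R" "v = (\<Sum>i\<in>I. e i * g i)"
        using \<open>v \<in> ?L\<close> by (auto simp: lincomb_def)
      have "y * g k \<in> ?L" if "k \<in> I" for k
      proof -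
        obtain i j where k: "k = (i, j)" "i < M" "j < N" using \<open>k \<in> I\<close> by (auto simp: I_def)
        show ?thesis
        proof (cases "Suc j < N")
          case True
          then show ?thesis using gen[of i "Suc j"] k by (simp add: g_def mult.left_commute)
        next
          case False
          then have "Suc j = N" using k by simp
          then have "y * g k = x ^ i * y ^ N"
            using k by (auto simp: g_def mult.left_commute)
          also have "\<dots> = (\<Sum>j<N. b j * (x ^ i * y ^ j))"
            unfolding b(2) by (simp add: sum_distrib_left mult.left_commute)
          also have "\<dots> \<in> ?L"
            using b(1) k by (intro lincomb_sum[OF R], intro lincomb_scale[OF R gen]) simp_all
          finally show ?thesis .
        qed
      qed
      then have "(\<Sum>i\<in>I. e i * (y * g i)) \<in> ?L"
        using e(1) by (intro lincomb_sum[OF R], rule_tac lincomb_scale[OF R]) simp_all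
      then show ?thesis by (simp add: e(2) sum_distrib_left mult.left_commute)
    qed
    have g: "\<exists>i\<in>I. g i \<noteq> 0" using M N by (intro bexI[of _ "(0, 0)"]) (auto simp: g_def I_def)
    have gL: "g i \<in> ?L" if "i \<in> I" for i by (rule lincomb_generator[OF R fin that])
    have "integral_over R (x + y)"
      by (rule integral_over_if_stable_module[OF R fin g])
        (auto simp: distrib_right intro!: lincomb_add[OF R] multx multy gL)
    moreover have "integral_over R (x * y)"
      by (rule integral_over_if_stable_module[OF R fin g])
        (auto simp: mult.assoc intro!: multx multy gL)
    ultimately show ?thesis ..
  qed
  have one: "integral_over R 1"
    using subring_one[OF R] by (intro integral_over_if_power[OF R, of 1 "\<lambda>_. 1"]) auto
  show ?thesis
    unfolding unital_subring_def
  proof (intro conjI ballI)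
    fix x y assume "x \<in> {x. integral_over R x}" "y \<in> {x. integral_over R x}"
    then show "x - y \<in> {x. integral_over R x}" "x * y \<in> {x. integral_over R x}"
      using both[of x "- y"] both[of x y] neg[of y] by auto
  qed (simp add: one)
qed

text \<open>The roots of \<open>p\<close> in an algebraic closure are roots of \<open>f\<close>, hence integral. The coefficients
  of \<open>p\<close> are polynomial expressions in these roots, hence integral as well.\<close>

lemma monic_factor_over_integrally_closed:
  fixes R :: "'a::field set"
  assumes R: "unital_subring R" and closed: "\<And>a. integral_over R a \<Longrightarrow> a \<in> R"
    and "lead_coeff f = 1" "poly_over R f" "lead_coeff p = 1" "p dvd f"
  shows "poly_over R p"
proof -
  have hom: "ring_hom_on UNIV to_ac" by (simp add: ring_hom_on_def)
  let ?S = "to_ac ` R" and ?P = "map_poly to_ac p" and ?F = "map_poly to_ac f"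
  have homR: "ring_hom_on R to_ac" by (simp add: ring_hom_on_def)
  note S = hom_image_subring[OF R homR]
  let ?I = "{x. integral_over ?S x}"
  note I = unital_subring_integral_closure[OF S]
  obtain h where "f = p * h" using \<open>p dvd f\<close> by (elim dvdE)
  then have "?P dvd ?F"
    by (simp add: map_poly_mult_on[OF unital_subring_UNIV hom poly_over_UNIV poly_over_UNIV])
  have "lead_coeff ?P = 1" "lead_coeff ?F = 1"
    using lead_coeff_map_poly_monic[OF unital_subring_UNIV hom] assms(3,5) by auto
  have "poly_over ?S ?F" by (rule poly_over_map_poly[OF R homR assms(4)])
  have root: "z \<in> ?I" if "poly ?P z = 0" for z
  proof -
    have "poly ?F z = 0" using \<open>?P dvd ?F\<close> that by (metis dvdE mult_eq_0_iff poly_mult)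
    then show ?thesis
      using \<open>lead_coeff ?F = 1\<close> \<open>poly_over ?S ?F\<close> unfolding integral_over_def by blast
  qed
  have "?P \<noteq> 0" using \<open>lead_coeff ?P = 1\<close> by auto
  then obtain A where A: "?P = (\<Prod>x\<in>#A. [:- x, 1:])"
    using alg_closed_imp_factorization[of ?P] \<open>lead_coeff ?P = 1\<close> by auto
  have "z \<in> ?I" if "z \<in># A" for z
    by (rule root) (use that in \<open>force simp: A poly_prod_mset\<close>)
  then have "poly_over ?I (\<Prod>x\<in>#A. [:- x, 1:])"
  proof (induction A)
    case (add z A)
    have "poly_over ?I [:- z, 1:]"
      using add.prems by (intro poly_over_pCons poly_over_zero subring_one subring_uminus I) auto
    then show ?case using add poly_over_mult[OF I] by (simp del: mult_pCons_left)
  qed (simp add: poly_over_one[OF I])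
  then have *: "integral_over ?S (to_ac (coeff p i))" for i
    unfolding A[symmetric] by (simp add: poly_over_def coeff_map_poly)
  have "integral_over R (coeff p i)" for i
  proof -
    obtain N b where b: "\<forall>j<N. b j \<in> ?S" "to_ac (coeff p i) ^ N = (\<Sum>j<N. b j * to_ac (coeff p i) ^ j)"
      using integral_over_imp_power[OF S *] by blast
    then have "\<forall>j. \<exists>a. j < N \<longrightarrow> a \<in> R \<and> b j = to_ac a" by auto
    then obtain a where a: "\<And>j. j < N \<Longrightarrow> a j \<in> R" "\<And>j. j < N \<Longrightarrow> b j = to_ac (a j)" by metis
    have "to_ac (coeff p i ^ N) = to_ac (\<Sum>j<N. a j * coeff p i ^ j)"
      using b(2) a(2) by (simp add: to_ac_sum)
    then have "coeff p i ^ N = (\<Sum>j<N. a j * coeff p i ^ j)" by (simp only: to_ac_eq_iff)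
    then show ?thesis
      using a(1) by (intro integral_over_if_power[OF R, of N a]) auto
  qed
  then show ?thesis using closed by (auto simp: poly_over_def)
qed

section \<open>Simple extensions and primitive elements\<close>

text \<open>A field extension is a homomorphism between two field types. The name \<open>hom_simps\<close> collects the
  homomorphism laws and \<open>map_simps\<close> their analogues for the induced map on polynomials.\<close>

locale field_extension =
  fixes \<sigma> :: "'f::field \<Rightarrow> 'e::field"
  assumes hom: "ring_hom_on UNIV \<sigma>"
begin

lemmas hom_simps = hom_zero[OF unital_subring_UNIV hom] hom_one[OF unital_subring_UNIV hom]
  hom_add[OF unital_subring_UNIV hom UNIV_I UNIV_I] hom_mult[OF unital_subring_UNIV hom UNIV_I UNIV_I]
  hom_diff[OF unital_subring_UNIV hom UNIV_I UNIV_I] hom_uminus[OF unital_subring_UNIV hom UNIV_I]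
  hom_sum[OF unital_subring_UNIV hom UNIV_I]

lemmas map_simps = map_poly_add_on[OF unital_subring_UNIV hom poly_over_UNIV poly_over_UNIV]
  map_poly_diff_on[OF unital_subring_UNIV hom poly_over_UNIV poly_over_UNIV]
  map_poly_mult_on[OF unital_subring_UNIV hom poly_over_UNIV poly_over_UNIV]

lemma hom_eq_0_iff: "\<sigma> x = 0 \<longleftrightarrow> x = 0"
  using hom_simps(1,2) hom_simps(4)[of x "inverse x"] by (metis mult_zero_left right_inverse zero_neq_one)

lemma hom_inject: "\<sigma> x = \<sigma> y \<longleftrightarrow> x = y"
  using hom_eq_0_iff[of "x - y"] by (simp add: hom_simps)

lemma map_poly_hom_eq_0_iff: "map_poly \<sigma> p = 0 \<longleftrightarrow> p = 0"
  by (rule map_poly_eq_0_iff) (auto simp: hom_simps hom_eq_0_iff)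

lemma map_poly_pderiv: "map_poly \<sigma> (pderiv p) = pderiv (map_poly \<sigma> p)"
proof -
  have "\<sigma> (of_nat n) = of_nat n" for n by (induction n) (simp_all add: hom_simps)
  then show ?thesis by (intro poly_eqI) (simp add: coeff_map_poly coeff_pderiv hom_simps del: of_nat_Suc)
qed

lemma is_min_poly_degree_pos:
  assumes "is_min_poly \<sigma> a p"
  shows "degree p > 0"
proof (rule gr0I)
  assume "degree p = 0"
  then have "p = [:1:]" using assms by (auto simp: is_min_poly_def elim: degree_eq_zeroE)
  then show False using assms by (simp add: is_min_poly_def map_poly_pCons hom_simps)
qed

lemma min_poly_dvd:
  assumes p: "is_min_poly \<sigma> a p" and q: "poly (map_poly \<sigma> q) a = 0"
  shows "p dvd q"
proof -
  have "map_poly \<sigma> q = map_poly \<sigma> (q div p) * map_poly \<sigma> p + map_poly \<sigma> (q mod p)"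
    by (simp flip: map_simps)
  then have "poly (map_poly \<sigma> (q mod p)) a = 0"
    using p q by (simp add: is_min_poly_def)
  moreover have "p \<noteq> 0" using p by (auto simp: is_min_poly_def)
  ultimately have "q mod p = 0"
    using p degree_mod_less[of p q] by (auto simp: is_min_poly_def)
  then show ?thesis by (simp add: mod_eq_0_iff_dvd)
qed

text \<open>The ring generated by the base field and \<open>a\<close>. It is a field when its elements are algebraic,
  by \<open>adjoin_inverse\<close> below.\<close>

definition adjoin :: "'e \<Rightarrow> 'e set" where
  "adjoin a = range (\<lambda>p. poly (map_poly \<sigma> p) a)"

lemma unital_subring_adjoin: "unital_subring (adjoin a)"
  unfolding unital_subring_def
proof (intro conjI ballI)
  show "1 \<in> adjoin a" unfolding adjoin_def by (rule range_eqI[of _ _ 1]) (simp add: hom_simps)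
  fix x y assume "x \<in> adjoin a" "y \<in> adjoin a"
  then obtain p q where "x = poly (map_poly \<sigma> p) a" "y = poly (map_poly \<sigma> q) a"
    by (auto simp: adjoin_def)
  then have "x - y = poly (map_poly \<sigma> (p - q)) a" "x * y = poly (map_poly \<sigma> (p * q)) a"
    by (auto simp: map_simps)
  then show "x - y \<in> adjoin a" "x * y \<in> adjoin a" by (auto simp: adjoin_def)
qed

lemma base_in_adjoin: "\<sigma> c \<in> adjoin a"
  unfolding adjoin_def by (rule range_eqI[of _ _ "[:c:]"]) (simp add: map_poly_pCons hom_simps)

lemma generator_in_adjoin: "a \<in> adjoin a"
  unfolding adjoin_def by (rule range_eqI[of _ _ "[:0, 1:]"]) (simp add: map_poly_pCons hom_simps)

lemma map_poly_over_adjoin: "poly_over (adjoin a) (map_poly \<sigma> p)"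
  by (simp add: poly_over_def coeff_map_poly hom_simps base_in_adjoin)

lemma adjoin_subset: "b \<in> adjoin a \<Longrightarrow> adjoin b \<subseteq> adjoin a"
  unfolding adjoin_def[of b] using poly_in_subring[OF unital_subring_adjoin map_poly_over_adjoin] by auto

text \<open>The minimal polynomial \<open>c + T q(T)\<close> of \<open>x \<noteq> 0\<close> has \<open>c \<noteq> 0\<close>, so that \<open>- q(x) / c\<close> is the
  inverse of \<open>x\<close>.\<close>

lemma adjoin_inverse:
  assumes x: "x \<in> adjoin a" and p: "is_min_poly \<sigma> x p"
  shows "inverse x \<in> adjoin a"
proof (cases "x = 0")
  case True
  then show ?thesis using x by simp
next
  case False
  obtain c q where q: "p = pCons c q" by (cases p)
  have x0: "\<sigma> c + x * poly (map_poly \<sigma> q) x = 0"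
    using p by (simp add: q is_min_poly_def map_poly_pCons hom_simps)
  have "q \<noteq> 0"
    using is_min_poly_degree_pos[OF p] by (auto simp: q)
  have "c \<noteq> 0"
  proof
    assume "c = 0"
    then have "poly (map_poly \<sigma> q) x = 0" using x0 False by (simp add: hom_simps)
    then show False using p \<open>q \<noteq> 0\<close> by (auto simp: q is_min_poly_def)
  qed
  have "poly (map_poly \<sigma> q) x \<in> adjoin a"
    by (rule poly_in_subring[OF unital_subring_adjoin map_poly_over_adjoin x])
  then have "\<sigma> (- inverse c) * poly (map_poly \<sigma> q) x \<in> adjoin a"
    by (intro subring_mult[OF unital_subring_adjoin] base_in_adjoin)
  moreover have "x * (\<sigma> (- inverse c) * poly (map_poly \<sigma> q) x) = 1"
  proof -
    have "x * poly (map_poly \<sigma> q) x = \<sigma> (- c)" using x0 by (simp add: hom_simps eq_neg_iff_add_eq_0 add.commute)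
    then have "x * (\<sigma> (- inverse c) * poly (map_poly \<sigma> q) x) = \<sigma> (- inverse c) * \<sigma> (- c)"
      by (simp add: mult.left_commute)
    also have "\<dots> = 1" using \<open>c \<noteq> 0\<close> by (simp flip: hom_simps(4)) (simp add: hom_simps)
    finally show ?thesis .
  qed
  ultimately show ?thesis by (metis inverse_unique)
qed

text \<open>The powers of a primitive element below the degree of its minimal polynomial form a basis.\<close>

lemma extension_degree_eq:
  assumes p: "is_min_poly \<sigma> a p" and all: "adjoin a = UNIV"
  shows "extension_degree \<sigma> = degree p"
proof -
  interpret vs: vector_space "\<lambda>c x. \<sigma> c * x"
    by standard (auto simp: hom_simps algebra_simps)
  define d where "d = degree p"
  have small: "q = 0" if "poly (map_poly \<sigma> q) a = 0" "degree q < d" for q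
    using p that by (auto simp: is_min_poly_def d_def not_le[symmetric])
  have d: "d > 0" using is_min_poly_degree_pos[OF p] by (simp add: d_def)
  have inj: "inj_on (\<lambda>i. a ^ i) {..<d}"
  proof (rule linorder_inj_onI)
    fix i j assume ij: "i < j" "i \<in> {..<d}" "j \<in> {..<d}"
    show "a ^ i \<noteq> a ^ j"
    proof
      assume eq: "a ^ i = a ^ j"
      define q :: "'f poly" where "q = monom 1 j - monom 1 i"
      have "degree q \<le> j" unfolding q_def using ij
        by (intro degree_diff_le) (auto intro: order.trans[OF degree_monom_le])
      moreover have "poly (map_poly \<sigma> q) a = 0"
        using eq by (simp add: q_def map_simps map_poly_monom hom_simps poly_monom)
      moreover have "coeff q j = 1" using ij by (simp add: q_def)
      ultimately show False using small[of q] ij by auto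
    qed
  qed auto
  let ?S = "(\<lambda>i. a ^ i) ` {..<d}"
  have "vs.dim UNIV = d"
  proof (rule vs.dim_unique[of ?S])
    show "card ?S = d" using card_image[OF inj] by simp
    show "vs.independent ?S"
    proof
      assume "vs.dependent ?S"
      then obtain u v where uv: "v \<in> ?S" "u v \<noteq> 0" "(\<Sum>v\<in>?S. \<sigma> (u v) * v) = 0"
        by (auto simp: vs.dependent_finite)
      define q where "q = (\<Sum>i<d. monom (u (a ^ i)) i)"
      have c: "coeff q i = (if i < d then u (a ^ i) else 0)" for i
        unfolding q_def coeff_sum by simp
      have "degree q < d"
        using d c by (intro degree_lessI) auto
      moreover have "map_poly \<sigma> q = (\<Sum>i<d. monom (\<sigma> (u (a ^ i))) i)"
        by (rule poly_eqI) (simp add: coeff_map_poly hom_simps c coeff_sum)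
      then have "poly (map_poly \<sigma> q) a = 0"
        using uv(3) by (simp add: poly_sum poly_monom sum.reindex[OF inj])
      ultimately have "q = 0" by (intro small)
      moreover obtain i where "v = a ^ i" "i < d" using uv(1) by auto
      ultimately show False using uv(2) c[of i] by simp
    qed
    show "UNIV \<subseteq> vs.span ?S"
    proof
      fix x :: 'e
      obtain f where f: "x = poly (map_poly \<sigma> f) a" using all by (auto simp: adjoin_def)
      define r where "r = f mod p"
      have "map_poly \<sigma> f = map_poly \<sigma> (f div p) * map_poly \<sigma> p + map_poly \<sigma> r"
        by (simp add: r_def flip: map_simps)
      then have x: "x = poly (map_poly \<sigma> r) a"
        using p by (simp add: f is_min_poly_def)
      have "p \<noteq> 0" using p by (auto simp: is_min_poly_def)
      then have "r = 0 \<or> degree r < d"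
        unfolding r_def d_def by (rule degree_mod_less)
      then have r: "degree r < d" using d by auto
      have "map_poly \<sigma> r = (\<Sum>i<d. monom (\<sigma> (coeff r i)) i)"
        using r by (intro poly_eqI) (auto simp: coeff_map_poly hom_simps coeff_sum coeff_eq_0)
      then have "x = (\<Sum>i<d. \<sigma> (coeff r i) * a ^ i)"
        by (simp add: x poly_sum poly_monom)
      also have "\<dots> \<in> vs.span ?S"
        by (intro vs.span_sum vs.span_scale vs.span_base) auto
      finally show "x \<in> vs.span ?S" .
    qed
  qed auto
  then show ?thesis by (simp add: extension_degree_def d_def)
qed

text \<open>The primitive element theorem in the form needed here: for all but finitely many \<open>c\<close> in the
  base field, \<open>K(a + c b)\<close> contains \<open>b\<close>. Let \<open>f\<close> and \<open>g\<close> be the minimal polynomials of \<open>a\<close> and \<open>b\<close> over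
  the base field \<open>K\<close>, and put \<open>e = a + c b\<close>. The minimal polynomial \<open>h\<close> of \<open>b\<close> over \<open>K(e)\<close> divides
  both \<open>g(T)\<close> and \<open>f(e - c T)\<close>. Away from the exceptional values of \<open>c\<close> these two have only the root
  \<open>b\<close> in common, and \<open>g\<close> has no multiple root, so \<open>h = T - b\<close>.\<close>

lemma primitive_combination:
  assumes sep: "separable_extension \<sigma>"
  shows "\<exists>B. finite B \<and> (\<forall>c \<in> range \<sigma> - B. b \<in> adjoin (a + c * b))"
proof -
  have ex_min: "\<exists>p. is_min_poly \<sigma> x p \<and> coprime p (pderiv p)" for x
    using sep by (auto simp: separable_extension_def separable_element_def)
  obtain f where f: "is_min_poly \<sigma> a f" using ex_min by blast
  obtain g where g: "is_min_poly \<sigma> b g" "coprime g (pderiv g)" using ex_min by blast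
  interpret ac: field_extension to_ac
    by standard (simp add: ring_hom_on_def)
  let ?F = "map_poly to_ac (map_poly \<sigma> f)" and ?G = "map_poly to_ac (map_poly \<sigma> g)"
  have nz: "?F \<noteq> 0" "?G \<noteq> 0"
    using f g by (auto simp: is_min_poly_def ac.map_poly_hom_eq_0_iff map_poly_hom_eq_0_iff)
  \<comment> \<open>The set \<open>B\<close> contains every \<open>c\<close> for which \<open>e - c z\<close> is a root \<open>y\<close> of \<open>f\<close> for some root \<open>z \<noteq> b\<close> of \<open>g\<close>.
    For \<open>z = b\<close> the quotient has the default value \<open>0\<close>, which does no harm.\<close>
  define B where "B = to_ac -` (\<lambda>(y, z). (y - to_ac a) / (to_ac b - z)) ` ({y. poly ?F y = 0} \<times> {z. poly ?G z = 0})"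
  have "finite B"
    unfolding B_def using nz by (intro finite_vimageI finite_imageI finite_cartesian_product poly_roots_finite inj_to_ac)
  moreover have "b \<in> adjoin (a + c * b)" if c: "c \<in> range \<sigma> - B" for c
  proof -
    define e where "e = a + c * b"
    let ?K = "adjoin e"
    note K = unital_subring_adjoin[of e]
    let ?P = "\<lambda>h. poly_over ?K h \<and> h \<noteq> 0 \<and> poly h b = 0"
    have "?P (map_poly \<sigma> g)"
      using g by (auto simp: map_poly_over_adjoin is_min_poly_def map_poly_hom_eq_0_iff)
    then obtain h0 where h0: "?P h0" "\<And>h. ?P h \<Longrightarrow> degree h0 \<le> degree h"
      using ex_has_least_nat[of ?P _ degree] by blast
    \<comment> \<open>The ring \<open>K(e)\<close> is a field, so \<open>h0\<close> can be made monic without leaving it.\<close>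
    define l where "l = inverse (lead_coeff h0)"
    define h where "h = smult l h0"
    have "lead_coeff h0 \<in> ?K" using h0(1) by (simp add: poly_over_def)
    then have "l \<in> ?K" unfolding l_def using ex_min adjoin_inverse by blast
    then have hK: "poly_over ?K h"
      using h0(1) by (auto simp: h_def poly_over_def intro: subring_mult[OF K])
    have l: "l \<noteq> 0" using h0(1) by (simp add: l_def)
    have h: "lead_coeff h = 1" "poly h b = 0" "degree h = degree h0"
      using h0(1) l by (auto simp: h_def l_def)
    have h_dvd: "h dvd q" if q: "poly_over ?K q" "poly q b = 0" for q
    proof -
      obtain s r where sr: "poly_over ?K s" "poly_over ?K r" "q = h * s + r" "r = 0 \<or> degree r < degree h"
        using monic_division_over[OF K h(1) hK q(1)] by blast
      have "poly r b = 0" using q(2) h(2) by (simp add: sr(3))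
      then have "r = 0" using sr(2,4) h0(2)[of r] h(3) by (metis not_le)
      then show ?thesis by (simp add: sr(3))
    qed
    have "h dvd map_poly \<sigma> g"
      using g by (intro h_dvd map_poly_over_adjoin) (simp add: is_min_poly_def)
    then obtain s where s: "map_poly \<sigma> g = h * s" by (elim dvdE)
    have cK: "c \<in> ?K" using c base_in_adjoin by auto
    let ?L = "[:e, - c:]"
    have "poly_over ?K (pcompose (map_poly \<sigma> f) ?L)"
      by (intro poly_over_pcompose K map_poly_over_adjoin poly_over_pCons poly_over_zero subring_uminus
          generator_in_adjoin cK)
    moreover have "poly (pcompose (map_poly \<sigma> f) ?L) b = 0"
      using f by (simp add: poly_pcompose e_def is_min_poly_def mult.commute)
    ultimately have "h dvd pcompose (map_poly \<sigma> f) ?L" by (rule h_dvd)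
    then obtain t where t: "pcompose (map_poly \<sigma> f) ?L = h * t" by (elim dvdE)
    let ?H = "map_poly to_ac h"
    have root: "z = to_ac b" if z: "poly ?H z = 0" for z
    proof (rule ccontr)
      assume neq: "z \<noteq> to_ac b"
      have G: "poly ?G z = 0" using z by (simp add: s ac.map_simps)
      have map_pcompose: "map_poly to_ac (pcompose p q) = pcompose (map_poly to_ac p) (map_poly to_ac q)" for p q :: "'e poly"
        by (induction p) (simp_all add: pcompose_pCons map_poly_pCons ac.map_simps)
      define y where "y = to_ac a + to_ac c * (to_ac b - z)"
      have "poly (pcompose ?F (map_poly to_ac ?L)) z = 0"
        using z by (simp add: t ac.map_simps flip: map_pcompose)
      then have F: "poly ?F y = 0"
        by (simp add: poly_pcompose map_poly_pCons y_def e_def algebra_simps)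
      have "to_ac c = (y - to_ac a) / (to_ac b - z)"
        using neq by (simp add: y_def)
      then have "c \<in> B" unfolding B_def using F G by (intro vimageI2 image_eqI[of _ _ "(y, z)"]) auto
      then show False using c by blast
    qed
    have "lead_coeff ?H = 1 \<and> degree ?H = degree h"
      by (rule lead_coeff_map_poly_monic[OF unital_subring_UNIV ac.hom h(1)]) simp
    then have H: "lead_coeff ?H = 1" "degree ?H = degree h" "?H \<noteq> 0" by auto
    obtain A where A: "size A = degree ?H" "?H = (\<Prod>x\<in>#A. [:- x, 1:])"
      using alg_closed_imp_factorization[OF H(3)] unfolding H(1) smult_1_left by blast
    have "x = to_ac b" if "x \<in># A" for x
      by (rule root) (use that in \<open>force simp: A(2) poly_prod_mset\<close>)
    then have "A = replicate_mset (degree h) (to_ac b)"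
      using A(1)[unfolded H(2)] set_mset_subset_singletonD[of A "to_ac b"] by auto
    then have Hpow: "?H = [:- to_ac b, 1:] ^ degree h" using A(2) by simp
    have "degree h \<noteq> 0"
    proof
      assume "degree h = 0"
      then obtain k where "h = [:k:]" by (rule degree_eq_zeroE)
      then show False using h(1,2) by simp
    qed
    \<comment> \<open>Otherwise \<open>b\<close> is a double root of \<open>g\<close>, so \<open>g\<close> divides its derivative by minimality.\<close>
    moreover have "\<not> degree h \<ge> 2"
    proof
      assume "degree h \<ge> 2"
      then have "[:- to_ac b, 1:] ^ 2 dvd ?G"
        unfolding s ac.map_simps Hpow by (intro dvd_mult2 le_imp_power_dvd)
      then obtain w where w: "?G = [:- to_ac b, 1:] ^ 2 * w" by (elim dvdE)
      have "poly (pderiv ?G) (to_ac b) = 0"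
        unfolding w by (simp add: pderiv_mult pderiv_power pderiv_pCons)
      then have "to_ac (poly (map_poly \<sigma> (pderiv g)) b) = 0"
        by (simp add: map_poly_pderiv poly_map_poly_on[OF unital_subring_UNIV ac.hom poly_over_UNIV UNIV_I, symmetric]
            ac.map_poly_pderiv)
      then have "poly (map_poly \<sigma> (pderiv g)) b = 0" by simp
      then have "g dvd pderiv g" by (rule min_poly_dvd[OF g(1)])
      then have "is_unit g" using g(2) by (simp add: coprime_def)
      then show False using is_min_poly_degree_pos[OF g(1)] by (auto simp: is_unit_poly_iff)
    qed
    ultimately have "degree h = 1" by linarith
    then obtain k l where kl: "h = [:k, l:]" by (rule degree1_coeffs)
    then have k: "h = [:k, 1:]" using h(1) \<open>degree h = 1\<close> by simp
    then have "b = - k" using h(2) by (simp add: eq_neg_iff_add_eq_0 add.commute)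
    moreover have "k \<in> ?K" using hK by (metis k poly_over_def coeff_pCons_0)
    ultimately show ?thesis using subring_uminus[OF K] by (simp add: e_def)
  qed
  ultimately show ?thesis by blast
qed

end

section \<open>Proper ideals and residues of coordinates\<close>

text \<open>Over a finite field, one plus the product of all linear polynomials has no root.\<close>

lemma infinite_alg_closed: "infinite (UNIV :: 'k::alg_closed_field set)"
proof
  assume fin: "finite (UNIV :: 'k set)"
  define p :: "'k poly" where "p = (\<Prod>a\<in>UNIV. [:- a, 1:])"
  have "degree p = card (UNIV :: 'k set)"
    unfolding p_def by (subst degree_prod_eq_sum_degree) auto
  then have "degree p > 0" using fin by (simp add: card_gt_0_iff)
  then have "degree (p + 1) > 0" by (simp add: degree_add_eq_left)
  then obtain x where "poly (p + 1) x = 0" using alg_closed_imp_poly_has_root by blast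
  moreover have "poly p x = 0" unfolding p_def using fin by (auto simp: poly_prod)
  ultimately show False by simp
qed

text \<open>A proper ideal of \<open>S\<close> stays proper when it is extended to a ring \<open>B\<close> that contains \<open>S\<close> and is
  finitely generated as a module. This is the lying-over theorem without prime ideals, and it
  follows from \<open>field_nakayama\<close>: if the extended ideal is all of \<open>B\<close>, then \<open>B\<close> is contained in \<open>q\<close>
  times itself.\<close>

lemma proper_ideal_extension:
  fixes g :: "'i \<Rightarrow> 'a::field"
  assumes S: "unital_subring S" and q: "is_ideal S q" "1 \<notin> q"
    and B: "unital_subring B" "B = lincomb A I g" and I: "finite I" and "A \<subseteq> S" "S \<subseteq> B"
    and gB: "\<And>i. i \<in> I \<Longrightarrow> g i \<in> B"
  shows "is_ideal B (lincomb q I g)" "q \<subseteq> lincomb q I g" "1 \<notin> lincomb q I g"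
proof -
  let ?J = "lincomb q I g"
  have qB: "a \<in> q \<Longrightarrow> a \<in> B" and qadd: "\<And>a b. a \<in> q \<Longrightarrow> b \<in> q \<Longrightarrow> a + b \<in> q"
    and qmult: "\<And>a b. a \<in> S \<Longrightarrow> b \<in> q \<Longrightarrow> b * a \<in> q" and q0: "0 \<in> q" for a
    using q assms(8) by (auto simp: is_ideal_def mult.commute)
  have J0: "0 \<in> ?J" unfolding lincomb_def using q0 by (intro CollectI exI[of _ "\<lambda>_. 0"]) auto
  have Jadd: "x + y \<in> ?J" if xy: "x \<in> ?J" "y \<in> ?J" for x y
  proof -
    obtain a b where "\<forall>i\<in>I. a i \<in> q" "\<forall>i\<in>I. b i \<in> q" "x = (\<Sum>i\<in>I. a i * g i)" "y = (\<Sum>i\<in>I. b i * g i)"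
      using xy by (auto simp: lincomb_def)
    then show ?thesis using qadd
      unfolding lincomb_def by (intro CollectI exI[of _ "\<lambda>i. a i + b i"]) (auto simp: distrib_right sum.distrib)
  qed
  have Jsum: "sum f K \<in> ?J" if "\<And>k. k \<in> K \<Longrightarrow> f k \<in> ?J" for f :: "'i \<Rightarrow> 'a" and K
    using that by (induction K rule: infinite_finite_induct) (auto intro: J0 Jadd)
  have qBJ: "a * b \<in> ?J" if ab: "a \<in> q" "b \<in> B" for a b
  proof -
    obtain c where c: "\<forall>i\<in>I. c i \<in> A" "b = (\<Sum>i\<in>I. c i * g i)"
      using ab(2) by (auto simp: B(2) lincomb_def)
    have "a * b = (\<Sum>i\<in>I. (a * c i) * g i)" by (simp add: c(2) sum_distrib_left mult.assoc)
    moreover have "\<forall>i\<in>I. a * c i \<in> q" using c(1) ab(1) qmult \<open>A \<subseteq> S\<close> by blast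
    ultimately show ?thesis unfolding lincomb_def by (intro CollectI exI[of _ "\<lambda>i. a * c i"]) simp
  qed
  have JB: "r * x \<in> ?J" if rx: "r \<in> B" "x \<in> ?J" for r x
  proof -
    obtain a where a: "\<forall>i\<in>I. a i \<in> q" "x = (\<Sum>i\<in>I. a i * g i)" using rx(2) by (auto simp: lincomb_def)
    have "r * x = (\<Sum>i\<in>I. a i * (r * g i))" by (simp add: a(2) sum_distrib_left mult.left_commute)
    also have "\<dots> \<in> ?J" using a(1) rx(1) gB subring_mult[OF B(1)] by (intro Jsum qBJ) auto
    finally show ?thesis .
  qed
  have "?J \<subseteq> B"
    unfolding lincomb_def using qB gB by (auto intro!: subring_sum[OF B(1)] subring_mult[OF B(1)])
  then show "is_ideal B ?J" using J0 Jadd JB by (auto simp: is_ideal_def)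
  show "q \<subseteq> ?J" using qBJ[OF _ subring_one[OF B(1)]] by auto
  show "1 \<notin> ?J"
  proof
    assume one: "1 \<in> ?J"
    have "\<forall>i\<in>I. \<exists>a. (\<forall>j\<in>I. a j \<in> q) \<and> g i = (\<Sum>j\<in>I. a j * g j)"
      using JB[OF gB one] by (auto simp: lincomb_def)
    then obtain M where "\<And>i j. i \<in> I \<Longrightarrow> j \<in> I \<Longrightarrow> M i j \<in> q" "\<And>i. i \<in> I \<Longrightarrow> g i = (\<Sum>j\<in>I. M i j * g j)"
      by metis
    then have "\<forall>i\<in>I. g i = 0" by (rule field_nakayama[OF S q I])
    then show False using one by (auto simp: lincomb_def)
  qed
qed

text \<open>Replacement for the Nullstellensatz. Suppose that each \<open>t \<in> T\<close> satisfies a monic equation over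
  the field of constants modulo the proper ideal \<open>J\<close>. That equation splits into linear factors
  \<open>t - \<kappa> z\<close>, and one of them can be added to \<open>J\<close> without making it the unit ideal, since otherwise
  their product would be a unit modulo \<open>J\<close>. Treating the elements of \<open>T\<close> in turn gives a proper ideal
  modulo which every \<open>t \<in> T\<close> is a constant.\<close>

lemma proper_ideal_with_residues:
  fixes \<kappa> :: "'k::alg_closed_field \<Rightarrow> 'a::field"
  assumes B: "unital_subring B" and \<kappa>: "ring_hom_on UNIV \<kappa>" "range \<kappa> \<subseteq> B"
    and J: "is_ideal B J" "1 \<notin> J" and "finite T" "T \<subseteq> B"
    and alg: "\<And>t. t \<in> T \<Longrightarrow> \<exists>p. lead_coeff p = 1 \<and> poly (map_poly \<kappa> p) t \<in> J"
  shows "\<exists>I. is_ideal B I \<and> J \<subseteq> I \<and> 1 \<notin> I \<and> (\<forall>t\<in>T. \<exists>z. t - \<kappa> z \<in> I)"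
  using assms(6-8)
proof (induction T rule: finite_induct)
  case empty
  then show ?case using J by blast
next
  case (insert t T)
  interpret \<kappa>: field_extension \<kappa> by standard (rule \<kappa>)
  obtain I where I: "is_ideal B I" "J \<subseteq> I" "1 \<notin> I" "\<forall>t\<in>T. \<exists>z. t - \<kappa> z \<in> I"
    using insert.IH insert.prems by auto
  have Iadd: "\<And>a b. a \<in> I \<Longrightarrow> b \<in> I \<Longrightarrow> a + b \<in> I" and Imult: "\<And>a b. a \<in> B \<Longrightarrow> b \<in> I \<Longrightarrow> a * b \<in> I"
    and I0: "0 \<in> I" and IB: "I \<subseteq> B"
    using I(1) by (auto simp: is_ideal_def)
  have tB: "t - \<kappa> z \<in> B" for z
    using insert.prems(1) \<kappa>(2) by (auto intro!: subring_diff[OF B])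
  let ?I = "\<lambda>z. {a + b * (t - \<kappa> z) | a b. a \<in> I \<and> b \<in> B}"
  have ideal: "is_ideal B (?I z)" for z
    unfolding is_ideal_def
  proof (intro conjI ballI)
    show "?I z \<subseteq> B" using IB tB by (auto intro!: subring_add[OF B] subring_mult[OF B])
    show "0 \<in> ?I z" using I0 subring_zero[OF B] by (intro CollectI exI[of _ 0]) simp
    fix x assume "x \<in> ?I z"
    then obtain a b where ab: "x = a + b * (t - \<kappa> z)" "a \<in> I" "b \<in> B" by blast
    show "w + x \<in> ?I z" if w: "w \<in> ?I z" for w
    proof -
      obtain c d where cd: "w = c + d * (t - \<kappa> z)" "c \<in> I" "d \<in> B" using w by blast
      have "w + x = (c + a) + (d + b) * (t - \<kappa> z)" by (simp add: ab cd algebra_simps)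
      then show ?thesis using ab cd Iadd subring_add[OF B] by blast
    qed
    show "r * x \<in> ?I z" if r: "r \<in> B" for r
    proof -
      have "r * x = r * a + (r * b) * (t - \<kappa> z)" by (simp add: ab algebra_simps)
      then show ?thesis using ab r Imult subring_mult[OF B] by blast
    qed
  qed
  obtain p where p: "lead_coeff p = 1" "poly (map_poly \<kappa> p) t \<in> J" using insert.prems by blast
  then have "p \<noteq> 0" by auto
  then obtain Z where Z: "p = (\<Prod>x\<in>#Z. [:- x, 1:])"
    using alg_closed_imp_factorization[of p] unfolding p(1) smult_1_left by blast
  have pZ: "poly (map_poly \<kappa> (\<Prod>x\<in>#Z. [:- x, 1:])) t = (\<Prod>z\<in>#Z. t - \<kappa> z)" for Z
    by (induction Z) (simp_all add: \<kappa>.map_simps map_poly_pCons \<kappa>.hom_simps del: mult_pCons_left)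
  have "\<exists>z. 1 \<notin> ?I z"
  proof (rule ccontr)
    assume "\<not> ?thesis"
    then have all: "\<exists>b\<in>B. 1 - b * (t - \<kappa> z) \<in> I" for z
    proof -
      have "1 \<in> ?I z" using \<open>\<not> (\<exists>z. 1 \<notin> ?I z)\<close> by blast
      then obtain a b where "1 = a + b * (t - \<kappa> z)" "a \<in> I" "b \<in> B" by blast
      moreover from this have "1 - b * (t - \<kappa> z) = a" by (simp add: diff_eq_eq)
      ultimately show ?thesis by blast
    qed
    \<comment> \<open>If all \<open>t - \<kappa> z\<close> are units modulo \<open>I\<close>, then so are their products.\<close>
    have "\<exists>b\<in>B. 1 - b * (\<Prod>z\<in>#Z. t - \<kappa> z) \<in> I" for Z
    proof (induction Z)
      case empty
      then show ?case using subring_one[OF B] I0 by (intro bexI[of _ 1]) auto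
    next
      case (add z Z)
      obtain b where b: "b \<in> B" "1 - b * (\<Prod>z\<in>#Z. t - \<kappa> z) \<in> I" using add.IH by blast
      obtain c where c: "c \<in> B" "1 - c * (t - \<kappa> z) \<in> I" using all by blast
      let ?P = "\<Prod>z\<in>#Z. t - \<kappa> z"
      have "(1 - c * (t - \<kappa> z)) + (c * (t - \<kappa> z)) * (1 - b * ?P) \<in> I"
        by (intro Iadd Imult b c subring_mult[OF B] tB)
      moreover have "(1 - c * (t - \<kappa> z)) + (c * (t - \<kappa> z)) * (1 - b * ?P) = 1 - (c * b) * ((t - \<kappa> z) * ?P)"
        by (simp add: algebra_simps)
      ultimately show ?case using b(1) c(1) subring_mult[OF B] by (intro bexI[of _ "c * b"]) simp_all
    qed
    then obtain b where b: "b \<in> B" "1 - b * (\<Prod>z\<in>#Z. t - \<kappa> z) \<in> I" by blast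
    have "b * (\<Prod>z\<in>#Z. t - \<kappa> z) \<in> I"
      using p(2) I(2) b(1) unfolding Z pZ by (intro Imult) auto
    from Iadd[OF b(2) this] have "1 \<in> I" by simp
    then show False using I(3) by contradiction
  qed
  then obtain z where z: "1 \<notin> ?I z" by blast
  have sub: "I \<subseteq> ?I z"
  proof
    fix a assume "a \<in> I"
    then show "a \<in> ?I z" using subring_zero[OF B] by (intro CollectI exI[of _ a] exI[of _ 0]) simp
  qed
  have "t - \<kappa> z \<in> ?I z" using I0 subring_one[OF B] by (intro CollectI exI[of _ 0] exI[of _ 1]) simp
  moreover have "\<exists>z'. s - \<kappa> z' \<in> ?I z" if "s \<in> T" for s using I(4) sub that by blast
  ultimately show ?case
    using ideal[of z] z sub I(2) by (intro exI[of _ "?I z"]) blast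
qed

section \<open>Coordinate rings inside function fields\<close>

lemma polynomial_functions_compose:
  assumes "\<And>i. (\<lambda>x. U x i) \<in> polynomial_functions" "q \<in> polynomial_functions"
  shows "(\<lambda>x. q (U x)) \<in> polynomial_functions"
  using assms(2) by induction (auto intro: polynomial_functions.intros assms(1))

text \<open>The coordinate ring of \<open>Z\<close> is handled through its image \<open>R\<close> in the function field, and its
  elements are written \<open>reg p\<close> for polynomial functions \<open>p\<close> on the ambient affine space.\<close>

locale affine_function_field =
  fixes Z :: "('n::finite \<Rightarrow> 'k::field) set" and j :: "(('n \<Rightarrow> 'k) \<Rightarrow> 'k) \<Rightarrow> 'f::field"
  assumes function_field: "function_field Z j"
begin

text \<open>The regular function on \<open>Z\<close> that is given by \<open>p\<close>, as an element of the function field.\<close>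

definition reg :: "(('n \<Rightarrow> 'k) \<Rightarrow> 'k) \<Rightarrow> 'f" where
  "reg p = j (\<lambda>x. if x \<in> Z then p x else 0)"

text \<open>Evaluation at \<open>x\<close>. It is meaningful for \<open>x \<in> Z\<close> and on \<open>R\<close>, where \<open>ev x (reg p) = p x\<close>.\<close>

definition ev :: "('n \<Rightarrow> 'k) \<Rightarrow> 'f \<Rightarrow> 'k" where
  "ev x a = inv_into (coordinate_ring Z) j a x"

text \<open>The embedding of the field of constants.\<close>

definition scalar :: "'k \<Rightarrow> 'f" where
  "scalar c = reg (\<lambda>_. c)"

abbreviation R :: "'f set" where "R \<equiv> reg ` polynomial_functions"

lemma R_eq: "R = j ` coordinate_ring Z"
  by (auto simp: reg_def coordinate_ring_def)

lemma reg_add: "p \<in> polynomial_functions \<Longrightarrow> q \<in> polynomial_functions \<Longrightarrow> reg (\<lambda>x. p x + q x) = reg p + reg q"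
  and reg_mult: "p \<in> polynomial_functions \<Longrightarrow> q \<in> polynomial_functions \<Longrightarrow> reg (\<lambda>x. p x * q x) = reg p * reg q"
proof -
  assume pq: "p \<in> polynomial_functions" "q \<in> polynomial_functions"
  let ?r = "\<lambda>p x. if x \<in> Z then p x else 0"
  have "?r p \<in> coordinate_ring Z" "?r q \<in> coordinate_ring Z"
    using pq by (auto simp: coordinate_ring_def)
  then have "j (\<lambda>x. ?r p x + ?r q x) = reg p + reg q" "j (\<lambda>x. ?r p x * ?r q x) = reg p * reg q"
    using function_field by (auto simp: function_field_def reg_def)
  moreover have "(\<lambda>x. ?r p x + ?r q x) = ?r (\<lambda>x. p x + q x)" "(\<lambda>x. ?r p x * ?r q x) = ?r (\<lambda>x. p x * q x)"
    by auto
  ultimately show "reg (\<lambda>x. p x + q x) = reg p + reg q" "reg (\<lambda>x. p x * q x) = reg p * reg q"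
    by (simp_all add: reg_def)
qed

lemma scalar_one: "scalar 1 = 1"
  using function_field by (simp add: function_field_def scalar_def reg_def)

lemma ring_hom_scalar: "ring_hom_on UNIV scalar"
  unfolding ring_hom_on_def
  using scalar_one by (auto simp: scalar_def reg_add[symmetric] reg_mult[symmetric] polynomial_functions.const)

sublocale scalar: field_extension scalar
  by standard (rule ring_hom_scalar)

lemma scalar_in_R: "scalar c \<in> R"
  by (auto simp: scalar_def polynomial_functions.const)

lemma reg_eq_iff:
  assumes "p \<in> polynomial_functions" "q \<in> polynomial_functions"
  shows "reg p = reg q \<longleftrightarrow> (\<forall>x\<in>Z. p x = q x)"
proof
  assume "reg p = reg q"
  moreover have "inj_on j (coordinate_ring Z)" using function_field by (simp add: function_field_def)
  ultimately have "(\<lambda>x. if x \<in> Z then p x else 0) = (\<lambda>x. if x \<in> Z then q x else 0)"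
    using assms by (auto simp: reg_def coordinate_ring_def dest: inj_onD)
  then show "\<forall>x\<in>Z. p x = q x" by meson
next
  assume "\<forall>x\<in>Z. p x = q x"
  then have "(\<lambda>x. if x \<in> Z then p x else 0) = (\<lambda>x. if x \<in> Z then q x else 0)" by auto
  then show "reg p = reg q" by (simp add: reg_def)
qed

lemma reg_eq_0_iff: "p \<in> polynomial_functions \<Longrightarrow> reg p = 0 \<longleftrightarrow> (\<forall>x\<in>Z. p x = 0)"
  using reg_eq_iff[of p "\<lambda>_. 0"] scalar.hom_simps(1) by (simp add: scalar_def polynomial_functions.const)

lemma reg_diff:
  assumes "p \<in> polynomial_functions" "q \<in> polynomial_functions"
  shows "(\<lambda>x. p x - q x) \<in> polynomial_functions" "reg (\<lambda>x. p x - q x) = reg p - reg q"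
proof -
  have m: "(\<lambda>x. - 1 * q x) \<in> polynomial_functions"
    by (intro polynomial_functions.intros assms)
  have "(\<lambda>x. p x + - 1 * q x) \<in> polynomial_functions" by (intro polynomial_functions.add assms m)
  then show *: "(\<lambda>x. p x - q x) \<in> polynomial_functions" by simp
  show "reg (\<lambda>x. p x - q x) = reg p - reg q"
    using reg_add[OF * assms(2)] by simp
qed

lemma unital_subring_R: "unital_subring R"
  unfolding unital_subring_def
proof (intro conjI ballI)
  show "1 \<in> R" using scalar_in_R[of 1] by (simp add: scalar_one)
  fix a b assume "a \<in> R" "b \<in> R"
  then obtain p q where pq: "p \<in> polynomial_functions" "q \<in> polynomial_functions" "a = reg p" "b = reg q" by blast
  show "a - b \<in> R" using reg_diff[OF pq(1,2)] pq(3,4) by (metis imageI)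
  show "a * b \<in> R" using reg_mult[OF pq(1,2)] polynomial_functions.mult[OF pq(1,2)] pq(3,4) by (metis imageI)
qed

lemma ev_reg:
  assumes "x \<in> Z" "p \<in> polynomial_functions"
  shows "ev x (reg p) = p x"
proof -
  have "(\<lambda>x. if x \<in> Z then p x else 0) \<in> coordinate_ring Z" using assms by (auto simp: coordinate_ring_def)
  then have "inv_into (coordinate_ring Z) j (reg p) = (\<lambda>x. if x \<in> Z then p x else 0)"
    using function_field by (auto simp: reg_def function_field_def intro: inv_into_f_f)
  then show ?thesis using assms by (simp add: ev_def)
qed

lemma ev_scalar: "x \<in> Z \<Longrightarrow> ev x (scalar c) = c"
  by (simp add: scalar_def ev_reg polynomial_functions.const)

lemma ring_hom_ev: "x \<in> Z \<Longrightarrow> ring_hom_on R (ev x)"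
  unfolding ring_hom_on_def using ev_scalar[of x 1]
  by (auto simp: scalar_one ev_reg reg_add[symmetric] reg_mult[symmetric] polynomial_functions.intros)

lemma fraction:
  obtains p q where "p \<in> polynomial_functions" "q \<in> polynomial_functions" "reg q \<noteq> 0" "a = reg p / reg q"
proof -
  obtain f g where fg: "f \<in> coordinate_ring Z" "g \<in> coordinate_ring Z" "j g \<noteq> 0" "a = j f / j g"
    using function_field by (metis function_field_def)
  then show thesis using that by (auto simp: coordinate_ring_def reg_def)
qed

end

section \<open>Finite separable covers of a normal variety\<close>

text \<open>A finite dominant morphism to a normal variety with separable function field extension. It is
  applied with \<open>V\<close>-hat and \<open>u1\<close> in the roles of \<open>V\<close> and \<open>u\<close>.\<close>

locale separable_cover =
  V: affine_function_field V jV + W: affine_function_field W jW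
  for V :: "('c::finite \<Rightarrow> 'k::alg_closed_field) set" and jV :: "(('c \<Rightarrow> 'k) \<Rightarrow> 'k) \<Rightarrow> 'h::field"
    and W :: "('b::finite \<Rightarrow> 'k) set" and jW :: "(('b \<Rightarrow> 'k) \<Rightarrow> 'k) \<Rightarrow> 'w::field" +
  fixes u :: "('c \<Rightarrow> 'k) \<Rightarrow> ('b \<Rightarrow> 'k)"
  assumes V_closed: "closedin zariski V"
    and dominant: "dominant_morphism V W u"
    and finite_mor: "finite_morphism V W u"
    and normal: "normal_variety W jW"
    and separable: "separable_extension (function_field_embedding V jV W jW u)"
begin

abbreviation \<sigma> :: "'w \<Rightarrow> 'h" where
  "\<sigma> \<equiv> function_field_embedding V jV W jW u"

text \<open>A polynomial map of the ambient affine spaces that agrees with \<open>u\<close> on \<open>V\<close>.\<close>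

definition U :: "('c \<Rightarrow> 'k) \<Rightarrow> ('b \<Rightarrow> 'k)" where
  "U x i = (SOME p. p \<in> polynomial_functions \<and> (\<forall>x\<in>V. u x i = p x)) x"

lemma U_polynomial: "(\<lambda>x. U x i) \<in> polynomial_functions" and u_eq_U: "x \<in> V \<Longrightarrow> u x = U x"
proof -
  define p where "p = (\<lambda>i. SOME p. p \<in> polynomial_functions \<and> (\<forall>x\<in>V. u x i = p x))"
  have "\<exists>p. p \<in> polynomial_functions \<and> (\<forall>x\<in>V. u x i = p x)" for i
    using dominant by (simp add: dominant_morphism_def morphism_def Bex_def)
  then have "p i \<in> polynomial_functions \<and> (\<forall>x\<in>V. u x i = p i x)" for i
    unfolding p_def by (rule someI_ex)
  moreover have "U x i = p i x" for x i by (simp add: U_def p_def)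
  ultimately show "(\<lambda>x. U x i) \<in> polynomial_functions" "x \<in> V \<Longrightarrow> u x = U x" by auto
qed

lemma u_in_W: "x \<in> V \<Longrightarrow> u x \<in> W"
  using dominant by (auto simp: dominant_morphism_def morphism_def)

text \<open>Pullback of functions along \<open>U\<close>; on \<open>V\<close> it is the comorphism of \<open>u\<close>.\<close>

definition pull :: "(('b \<Rightarrow> 'k) \<Rightarrow> 'k) \<Rightarrow> ('c \<Rightarrow> 'k) \<Rightarrow> 'k" where
  "pull p = (\<lambda>x. p (U x))"

lemma pull_polynomial: "p \<in> polynomial_functions \<Longrightarrow> pull p \<in> polynomial_functions"
  unfolding pull_def by (rule polynomial_functions_compose[OF U_polynomial])

lemma comorphism_restrict:
  "comorphism V u (\<lambda>y. if y \<in> W then p y else 0) = (\<lambda>x. if x \<in> V then pull p x else 0)"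
  by (auto simp: comorphism_def pull_def u_eq_U[symmetric] u_in_W)

text \<open>Pullback of regular functions is injective because the image of \<open>u\<close> is dense.\<close>

lemma pull_eq_0_iff:
  assumes p: "p \<in> polynomial_functions"
  shows "V.reg (pull p) = 0 \<longleftrightarrow> W.reg p = 0"
proof
  assume "V.reg (pull p) = 0"
  then have "u ` V \<subseteq> zero_locus {p}"
    unfolding V.reg_eq_0_iff[OF pull_polynomial[OF p]] by (auto simp: pull_def u_eq_U zero_locus_def)
  moreover have "closedin zariski (zero_locus {p})" using p by (auto simp: closedin_zariski)
  ultimately have "zariski closure_of (u ` V) \<subseteq> zero_locus {p}" by (rule closure_of_minimal)
  then have "W \<subseteq> zero_locus {p}" using dominant by (simp add: dominant_morphism_def)
  then show "W.reg p = 0" by (auto simp: W.reg_eq_0_iff p zero_locus_def)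
next
  assume "W.reg p = 0"
  then show "V.reg (pull p) = 0"
    unfolding V.reg_eq_0_iff[OF pull_polynomial[OF p]] W.reg_eq_0_iff[OF p]
    by (auto simp: pull_def u_in_W simp flip: u_eq_U)
qed

lemma pull_reg_arith:
  assumes "p \<in> polynomial_functions" "q \<in> polynomial_functions"
  shows "V.reg (pull (\<lambda>y. p y + q y)) = V.reg (pull p) + V.reg (pull q)"
    "V.reg (pull (\<lambda>y. p y * q y)) = V.reg (pull p) * V.reg (pull q)"
  using V.reg_add[OF pull_polynomial pull_polynomial, OF assms] V.reg_mult[OF pull_polynomial pull_polynomial, OF assms]
  by (simp_all add: pull_def)

lemma pull_reg_cong:
  assumes "p \<in> polynomial_functions" "q \<in> polynomial_functions" "W.reg p = W.reg q"
  shows "V.reg (pull p) = V.reg (pull q)"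
  using assms(3) unfolding V.reg_eq_iff[OF pull_polynomial pull_polynomial, OF assms(1,2)] W.reg_eq_iff[OF assms(1,2)]
  by (auto simp: pull_def u_in_W simp flip: u_eq_U)

lemma \<sigma>_fraction:
  assumes p: "p \<in> polynomial_functions" and q: "q \<in> polynomial_functions" and nz: "W.reg q \<noteq> 0"
  shows "\<sigma> (W.reg p / W.reg q) = V.reg (pull p) / V.reg (pull q)"
  unfolding function_field_embedding_def
proof (rule the_equality)
  show "\<exists>f\<in>coordinate_ring W. \<exists>g\<in>coordinate_ring W. jW g \<noteq> 0 \<and> W.reg p / W.reg q = jW f / jW g \<and>
    V.reg (pull p) / V.reg (pull q) = jV (comorphism V u f) / jV (comorphism V u g)"
    using p q nz unfolding coordinate_ring_def bex_simps comorphism_restrict V.reg_def W.reg_def by blast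
  fix b assume "\<exists>f\<in>coordinate_ring W. \<exists>g\<in>coordinate_ring W. jW g \<noteq> 0 \<and> W.reg p / W.reg q = jW f / jW g \<and>
    b = jV (comorphism V u f) / jV (comorphism V u g)"
  then obtain p' q' where pq': "p' \<in> polynomial_functions" "q' \<in> polynomial_functions" "W.reg q' \<noteq> 0"
    "W.reg p / W.reg q = W.reg p' / W.reg q'" "b = V.reg (pull p') / V.reg (pull q')"
    unfolding coordinate_ring_def bex_simps comorphism_restrict V.reg_def W.reg_def by blast
  have "W.reg (\<lambda>y. p y * q' y) = W.reg (\<lambda>y. p' y * q y)"
    using pq'(4) unfolding frac_eq_eq[OF nz pq'(3)] by (simp add: W.reg_mult p q pq'(1,2))
  then have "V.reg (pull (\<lambda>y. p y * q' y)) = V.reg (pull (\<lambda>y. p' y * q y))"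
    by (intro pull_reg_cong polynomial_functions.mult p q pq')
  then have "V.reg (pull p) * V.reg (pull q') = V.reg (pull p') * V.reg (pull q)"
    by (simp add: pull_reg_arith p q pq')
  moreover have "V.reg (pull q) \<noteq> 0" "V.reg (pull q') \<noteq> 0"
    using nz pq' q by (simp_all add: pull_eq_0_iff)
  ultimately show "b = V.reg (pull p) / V.reg (pull q)" by (simp add: pq'(5) frac_eq_eq)
qed

lemma pull_const: "pull (\<lambda>_. c) = (\<lambda>_. c)"
  by (simp add: pull_def)

lemma \<sigma>_reg: "p \<in> polynomial_functions \<Longrightarrow> \<sigma> (W.reg p) = V.reg (pull p)"
  using \<sigma>_fraction[of p "\<lambda>_. 1"] W.scalar_one V.scalar_one
  by (simp add: polynomial_functions.const pull_const V.scalar_def W.scalar_def)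

lemma \<sigma>_scalar: "\<sigma> (W.scalar c) = V.scalar c"
  by (simp add: W.scalar_def V.scalar_def \<sigma>_reg polynomial_functions.const pull_const)

lemma ring_hom_\<sigma>: "ring_hom_on UNIV \<sigma>"
  unfolding ring_hom_on_def
proof (intro conjI ballI)
  show "\<sigma> 1 = 1" using \<sigma>_scalar[of 1] by (simp add: W.scalar_one V.scalar_one)
  fix a b
  obtain p q where pq: "p \<in> polynomial_functions" "q \<in> polynomial_functions" "W.reg q \<noteq> 0" "a = W.reg p / W.reg q"
    by (rule W.fraction)
  obtain r s where rs: "r \<in> polynomial_functions" "s \<in> polynomial_functions" "W.reg s \<noteq> 0" "b = W.reg r / W.reg s"
    by (rule W.fraction)
  note pf = pq(1,2) rs(1,2)
  have nz: "V.reg (pull q) \<noteq> 0" "V.reg (pull s) \<noteq> 0"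
    using pq rs by (simp_all add: pull_eq_0_iff)
  have den: "W.reg (\<lambda>y. q y * s y) \<noteq> 0" using pq rs by (simp add: W.reg_mult)
  have "a + b = W.reg (\<lambda>y. p y * s y + r y * q y) / W.reg (\<lambda>y. q y * s y)"
    unfolding pq(4) rs(4) add_frac_eq[OF pq(3) rs(3)]
    by (simp add: W.reg_mult W.reg_add polynomial_functions.mult pf)
  then have "\<sigma> (a + b) = V.reg (pull (\<lambda>y. p y * s y + r y * q y)) / V.reg (pull (\<lambda>y. q y * s y))"
    using den by (simp add: \<sigma>_fraction polynomial_functions.intros pf)
  also have "\<dots> = \<sigma> a + \<sigma> b"
    unfolding pq(4) rs(4) \<sigma>_fraction[OF pq(1-3)] \<sigma>_fraction[OF rs(1-3)] add_frac_eq[OF nz]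
    by (simp add: pull_reg_arith polynomial_functions.mult pf)
  finally show "\<sigma> (a + b) = \<sigma> a + \<sigma> b" .
  have "a * b = W.reg (\<lambda>y. p y * r y) / W.reg (\<lambda>y. q y * s y)"
    using pq rs by (simp add: W.reg_mult)
  then have "\<sigma> (a * b) = V.reg (pull (\<lambda>y. p y * r y)) / V.reg (pull (\<lambda>y. q y * s y))"
    using den by (simp add: \<sigma>_fraction polynomial_functions.intros pf)
  also have "\<dots> = \<sigma> a * \<sigma> b"
    using pq rs by (simp add: \<sigma>_fraction pull_reg_arith)
  finally show "\<sigma> (a * b) = \<sigma> a * \<sigma> b" .
qed

sublocale ext: field_extension \<sigma>
  by standard (rule ring_hom_\<sigma>)

text \<open>The coordinate ring of \<open>W\<close>, embedded in the function field of \<open>V\<close>.\<close>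

abbreviation A :: "'h set" where "A \<equiv> \<sigma> ` W.R"

lemma hom_on_R: "ring_hom_on W.R \<sigma>"
  using ring_hom_\<sigma> by (simp add: ring_hom_on_def)

lemma unital_subring_A: "unital_subring A"
  by (rule hom_image_subring[OF W.unital_subring_R hom_on_R])

lemma A_subset: "A \<subseteq> V.R"
  by (auto simp: \<sigma>_reg pull_polynomial)

text \<open>The coordinate ring of \<open>V\<close> is a finitely generated module over that of \<open>W\<close>.\<close>

lemma finite_generators:
  obtains G where "finite G" "jV ` G \<subseteq> V.R" "V.R = lincomb A G jV"
proof -
  obtain G where G: "finite G" "G \<subseteq> coordinate_ring V"
    "\<And>f. f \<in> coordinate_ring V \<Longrightarrow> \<exists>c. (\<forall>g\<in>G. c g \<in> coordinate_ring W) \<and>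
        f = (\<lambda>x. \<Sum>g\<in>G. comorphism V u (c g) x * g x)"
    using finite_mor unfolding finite_morphism_def by blast
  have GR: "jV ` G \<subseteq> V.R" using G(2) by (auto simp: V.R_eq)
  have "V.reg p \<in> lincomb A G jV" if p: "p \<in> polynomial_functions" for p
  proof -
    have "(\<lambda>x. if x \<in> V then p x else 0) \<in> coordinate_ring V" using p by (auto simp: coordinate_ring_def)
    then obtain c where c: "\<forall>g\<in>G. c g \<in> coordinate_ring W"
      "(\<lambda>x. if x \<in> V then p x else 0) = (\<lambda>x. \<Sum>g\<in>G. comorphism V u (c g) x * g x)"
      using G(3) by blast
    have "\<forall>g\<in>G. \<exists>q. q \<in> polynomial_functions \<and> c g = (\<lambda>y. if y \<in> W then q y else 0)"
      using c(1) by (auto simp: coordinate_ring_def)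
    then obtain q where q: "\<And>g. g \<in> G \<Longrightarrow> q g \<in> polynomial_functions"
      "\<And>g. g \<in> G \<Longrightarrow> c g = (\<lambda>y. if y \<in> W then q g y else 0)" by metis
    have "\<forall>g\<in>G. \<exists>r. r \<in> polynomial_functions \<and> g = (\<lambda>x. if x \<in> V then r x else 0)"
      using G(2) by (auto simp: coordinate_ring_def)
    then obtain r where r: "\<And>g. g \<in> G \<Longrightarrow> r g \<in> polynomial_functions"
      "\<And>g. g \<in> G \<Longrightarrow> g = (\<lambda>x. if x \<in> V then r g x else 0)" by metis
    have "(\<lambda>x. \<Sum>g\<in>H. pull (q g) x * r g x) \<in> polynomial_functions \<and>
        V.reg (\<lambda>x. \<Sum>g\<in>H. pull (q g) x * r g x) = (\<Sum>g\<in>H. \<sigma> (W.reg (q g)) * jV g)" if "H \<subseteq> G" for H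
      using finite_subset[OF that G(1)] that
    proof (induction H rule: finite_induct)
      case empty
      then show ?case using V.scalar.hom_simps(1) by (simp add: V.scalar_def polynomial_functions.const)
    next
      case (insert g H)
      have g: "q g \<in> polynomial_functions" "r g \<in> polynomial_functions" "V.reg (r g) = jV g"
        using insert.prems q r by (auto simp: V.reg_def r(2)[symmetric])
      have m: "(\<lambda>x. pull (q g) x * r g x) \<in> polynomial_functions"
        by (intro polynomial_functions.mult pull_polynomial g)
      show ?case
        using insert g m by (simp add: polynomial_functions.add V.reg_add V.reg_mult pull_polynomial \<sigma>_reg)
    qed
    from this[OF order_refl] have *: "(\<lambda>x. \<Sum>g\<in>G. pull (q g) x * r g x) \<in> polynomial_functions"
      "V.reg (\<lambda>x. \<Sum>g\<in>G. pull (q g) x * r g x) = (\<Sum>g\<in>G. \<sigma> (W.reg (q g)) * jV g)" by auto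
    have "V.reg p = V.reg (\<lambda>x. \<Sum>g\<in>G. pull (q g) x * r g x)"
      unfolding V.reg_eq_iff[OF p *(1)]
    proof
      fix x assume x: "x \<in> V"
      have "p x = (\<Sum>g\<in>G. comorphism V u (c g) x * g x)" using fun_cong[OF c(2), of x] x by simp
      also have "\<dots> = (\<Sum>g\<in>G. pull (q g) x * r g x)"
      proof (rule sum.cong)
        fix g assume g: "g \<in> G"
        have "g x = r g x" using r(2)[OF g] x by meson
        moreover have "comorphism V u (c g) x = pull (q g) x"
          using x by (simp add: q(2)[OF g] comorphism_restrict)
        ultimately show "comorphism V u (c g) x * g x = pull (q g) x * r g x" by simp
      qed simp
      finally show "p x = (\<Sum>g\<in>G. pull (q g) x * r g x)" .
    qed
    then show ?thesis
      unfolding lincomb_def using q(1) *(2)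
      by (intro CollectI exI[of _ "\<lambda>g. \<sigma> (W.reg (q g))"]) auto
  qed
  moreover have "lincomb A G jV \<subseteq> V.R"
    unfolding lincomb_def using A_subset GR
    by (auto intro!: subring_sum[OF V.unital_subring_R] subring_mult[OF V.unital_subring_R])
  ultimately show thesis using that G(1) GR by blast
qed

lemma integral_R:
  assumes "b \<in> V.R"
  shows "integral_over A b"
proof -
  obtain G where G: "finite G" "jV ` G \<subseteq> V.R" "V.R = lincomb A G jV" by (rule finite_generators)
  show ?thesis
  proof (rule integral_over_if_stable_module[OF unital_subring_A G(1)])
    show "\<exists>g\<in>G. jV g \<noteq> 0"
    proof (rule ccontr)
      assume "\<not> ?thesis"
      then have "lincomb A G jV \<subseteq> {0}" by (auto simp: lincomb_def)
      then show False using G(3) subring_one[OF V.unital_subring_R] by auto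
    qed
    fix g assume "g \<in> G"
    then have "b * jV g \<in> V.R" using G(2) assms by (intro subring_mult[OF V.unital_subring_R]) auto
    then show "b * jV g \<in> lincomb A G jV" unfolding G(3)[symmetric] .
  qed
qed

text \<open>The integral equation of a regular function, with its coefficients moved from \<open>A\<close> back to the
  function field of \<open>W\<close>.\<close>

lemma integral_equation:
  assumes "b \<in> V.R"
  shows "\<exists>f. lead_coeff f = 1 \<and> poly_over W.R f \<and> poly (map_poly \<sigma> f) b = 0"
proof -
  obtain f' where f': "lead_coeff f' = 1" "poly_over A f'" "poly f' b = 0"
    using integral_R[OF assms] by (auto simp: integral_over_def)
  obtain f where f: "poly_over W.R f" "map_poly \<sigma> f = f'"
    using poly_over_image_lift[OF f'(2)] ext.hom_simps(1) subring_zero[OF W.unital_subring_R] by blast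
  have "degree f' = degree f"
    unfolding f(2)[symmetric] by (rule degree_map_poly) (simp add: ext.hom_eq_0_iff)
  then have "\<sigma> (lead_coeff f) = \<sigma> 1"
    using f'(1) by (simp add: f(2)[symmetric] coeff_map_poly ext.hom_simps)
  then have "lead_coeff f = 1" by (simp only: ext.hom_inject)
  then show ?thesis using f f' by blast
qed

text \<open>This is the only place where normality of \<open>W\<close> enters.\<close>

lemma min_poly_over_R:
  assumes "b \<in> V.R" and p: "is_min_poly \<sigma> b p"
  shows "poly_over W.R p"
proof -
  obtain f where f: "lead_coeff f = 1" "poly_over W.R f" "poly (map_poly \<sigma> f) b = 0"
    using integral_equation[OF assms(1)] by blast
  show ?thesis
  proof (rule monic_factor_over_integrally_closed[OF W.unital_subring_R _ f(1,2)])
    show "lead_coeff p = 1" using p by (simp add: is_min_poly_def)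
    show "p dvd f" by (rule ext.min_poly_dvd[OF p f(3)])
    fix a assume "integral_over W.R a"
    then show "a \<in> W.R"
      using normal unfolding normal_variety_def integral_over_def poly_over_def W.R_eq by blast
  qed
qed

text \<open>If \<open>p\<close> annihilates the regular function \<open>t\<close>, then the values of \<open>t\<close> on the fibre over \<open>y\<close> are
  roots of the specialisation of \<open>p\<close> at \<open>y\<close>.\<close>

lemma root_at_point:
  assumes x: "x \<in> V" and t: "t \<in> polynomial_functions" and p: "poly_over W.R p"
    and root: "poly (map_poly \<sigma> p) (V.reg t) = 0"
  shows "poly (map_poly (W.ev (u x)) p) (t x) = 0"
proof -
  note hV = V.ring_hom_ev[OF x] and hW = W.ring_hom_ev[OF u_in_W[OF x]]
  have "poly_over V.R (map_poly \<sigma> p)"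
    using poly_over_map_poly[OF W.unital_subring_R hom_on_R p] A_subset by (rule poly_over_mono)
  then have "poly (map_poly (V.ev x) (map_poly \<sigma> p)) (V.ev x (V.reg t)) = V.ev x (poly (map_poly \<sigma> p) (V.reg t))"
    using t by (intro poly_map_poly_on[OF V.unital_subring_R hV]) auto
  also have "\<dots> = 0" by (simp add: root hom_zero[OF V.unital_subring_R hV])
  finally have "poly (map_poly (V.ev x) (map_poly \<sigma> p)) (t x) = 0" by (simp add: V.ev_reg x t)
  moreover have "map_poly (V.ev x) (map_poly \<sigma> p) = map_poly (W.ev (u x)) p"
  proof (rule poly_eqI)
    fix i
    obtain q where "q \<in> polynomial_functions" "coeff p i = W.reg q" using p by (auto simp: poly_over_def)
    then show "coeff (map_poly (V.ev x) (map_poly \<sigma> p)) i = coeff (map_poly (W.ev (u x)) p) i"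
      by (simp add: coeff_map_poly hom_zero[OF V.unital_subring_R hV] hom_zero[OF W.unital_subring_R hW]
          ext.hom_simps \<sigma>_reg V.ev_reg W.ev_reg pull_polynomial x u_in_W) (simp add: pull_def u_eq_U x)
  qed
  ultimately show ?thesis by simp
qed

text \<open>Conversely, every root \<open>z0\<close> of the specialised minimal polynomial is the value of \<open>t\<close> at a point
  of the fibre. In the ring \<open>S = k[W][t]\<close>, the elements \<open>p(t)\<close> with \<open>p(y, z0) = 0\<close> form an ideal
  \<open>q\<close>. It is proper: as \<open>k[W]\<close> is integrally closed, \<open>P\<close> has coefficients in \<open>k[W]\<close>, so division by
  \<open>P\<close> shows that the value \<open>p(y, z0)\<close> depends only on \<open>p(t)\<close>. Its extension to \<open>k[V]\<close> is contained
  in a proper ideal modulo which all coordinate functions are constants, and these constants are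
  the coordinates of the required point.\<close>

lemma point_over_root:
  assumes y: "y \<in> W" and t: "t \<in> polynomial_functions" and P: "is_min_poly \<sigma> (V.reg t) P"
    and z0: "poly (map_poly (W.ev y) P) z0 = 0"
  shows "\<exists>x\<in>V. u x = y \<and> t x = z0"
proof -
  let ?ev = "W.ev y" and ?\<xi> = "V.reg t"
  note hW = W.ring_hom_ev[OF y] and RW = W.unital_subring_R and RV = V.unital_subring_R
  note hW0 = hom_zero[OF RW hW] and hW1 = hom_one[OF RW hW]
  \<comment> \<open>\<open>val p\<close> is \<open>p(t)\<close> in the function field of \<open>V\<close>, and \<open>spec p\<close> is \<open>p(y, z0)\<close>.\<close>
  define val where "val = (\<lambda>p. poly (map_poly \<sigma> p) ?\<xi>)"
  define spec where "spec = (\<lambda>p. poly (map_poly ?ev p) z0)"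
  have val_hom: "val (p + q) = val p + val q" "val (p - q) = val p - val q" "val (p * q) = val p * val q" for p q
    by (simp_all add: val_def ext.map_simps)
  have val_pCons: "val [:a:] = \<sigma> a" for a by (simp add: val_def map_poly_pCons ext.hom_simps)
  have spec_hom: "spec (p + q) = spec p + spec q" "spec (p - q) = spec p - spec q" "spec (p * q) = spec p * spec q"
    if "poly_over W.R p" "poly_over W.R q" for p q
    using that by (simp_all add: spec_def map_poly_add_on[OF RW hW] map_poly_diff_on[OF RW hW] map_poly_mult_on[OF RW hW])
  define S where "S = {val p | p. poly_over W.R p}"
  define q where "q = {val p | p. poly_over W.R p \<and> spec p = 0}"
  have one: "val 1 = 1" "spec 1 = 1" by (simp_all add: val_def spec_def ext.hom_simps hW1)
  have const_over: "poly_over W.R [:a:]" if "a \<in> W.R" for a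
    by (intro poly_over_pCons poly_over_zero RW that)
  have S: "unital_subring S"
    unfolding unital_subring_def
  proof (intro conjI ballI)
    show "1 \<in> S" unfolding S_def using one poly_over_one[OF RW] by (metis (mono_tags) mem_Collect_eq)
    fix a b assume "a \<in> S" "b \<in> S"
    then obtain p r where pr: "a = val p" "b = val r" "poly_over W.R p" "poly_over W.R r" by (auto simp: S_def)
    then have "a - b = val (p - r)" "a * b = val (p * r)" by (simp_all add: val_hom)
    then show "a - b \<in> S" "a * b \<in> S"
      using poly_over_diff[OF RW pr(3,4)] poly_over_mult[OF RW pr(3,4)] by (auto simp: S_def)
  qed
  have q: "is_ideal S q"
    unfolding is_ideal_def
  proof (intro conjI ballI)
    show "q \<subseteq> S" by (auto simp: q_def S_def)
    have "val 0 = 0" "spec 0 = 0" by (simp_all add: val_def spec_def)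
    then show "0 \<in> q" unfolding q_def using poly_over_zero[OF RW] by (metis (mono_tags, lifting) mem_Collect_eq)
    fix b assume "b \<in> q"
    then obtain r where r: "b = val r" "poly_over W.R r" "spec r = 0" by (auto simp: q_def)
    show "a + b \<in> q" if a: "a \<in> q" for a
    proof -
      obtain p where p: "a = val p" "poly_over W.R p" "spec p = 0" using a by (auto simp: q_def)
      then have "a + b = val (p + r)" "spec (p + r) = 0" using r by (simp_all add: val_hom spec_hom)
      then show ?thesis using poly_over_add[OF RW p(2) r(2)] unfolding q_def by blast
    qed
    show "a * b \<in> q" if a: "a \<in> S" for a
    proof -
      obtain p where p: "a = val p" "poly_over W.R p" using a by (auto simp: S_def)
      then have "a * b = val (p * r)" "spec (p * r) = 0" using r by (simp_all add: val_hom spec_hom)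
      then show ?thesis using poly_over_mult[OF RW p(2) r(2)] unfolding q_def by blast
    qed
  qed
  have "1 \<notin> q"
  proof
    assume "1 \<in> q"
    then obtain p where p: "val p = 1" "poly_over W.R p" "spec p = 0" by (auto simp: q_def)
    have \<xi>: "?\<xi> \<in> V.R" using t by blast
    have Pm: "lead_coeff P = 1" "val P = 0" using P by (simp_all add: is_min_poly_def val_def)
    have PR: "poly_over W.R P" by (rule min_poly_over_R[OF \<xi> P])
    have over: "poly_over W.R (1 - p)" by (intro poly_over_diff poly_over_one RW p)
    obtain s r where sr: "poly_over W.R s" "poly_over W.R r" "1 - p = P * s + r" "r = 0 \<or> degree r < degree P"
      using monic_division_over[OF RW Pm(1) PR over] by blast
    have "val (1 - p) = val P * val s + val r" unfolding sr(3) by (simp add: val_hom)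
    then have "val r = 0" by (simp add: val_hom one p(1) Pm(2))
    then have "r = 0" using sr(4) P by (auto simp: is_min_poly_def val_def)
    then have "spec (1 - p) = spec P * spec s" using spec_hom(3)[OF PR sr(1)] by (simp add: sr(3))
    moreover have "spec P = 0" using z0 by (simp add: spec_def)
    ultimately show False using spec_hom(2)[OF poly_over_one[OF RW] p(2)] by (simp add: one p(3))
  qed
  obtain G where G: "finite G" "jV ` G \<subseteq> V.R" "V.R = lincomb A G jV" by (rule finite_generators)
  have AS: "A \<subseteq> S"
    unfolding S_def using const_over val_pCons by (force intro!: exI[of _ "[:_:]"])
  have SV: "S \<subseteq> V.R"
  proof
    fix a assume "a \<in> S"
    then obtain p where p: "a = val p" "poly_over W.R p" by (auto simp: S_def)
    have "poly_over V.R (map_poly \<sigma> p)"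
      using poly_over_map_poly[OF RW hom_on_R p(2)] A_subset by (rule poly_over_mono)
    then show "a \<in> V.R" unfolding p(1) val_def using t by (intro poly_in_subring[OF RV]) auto
  qed
  let ?J = "lincomb q G jV"
  have J: "is_ideal V.R ?J" "q \<subseteq> ?J" "1 \<notin> ?J"
    using proper_ideal_extension[OF S q \<open>1 \<notin> q\<close> RV G(3) G(1) AS SV] G(2) by blast+
  \<comment> \<open>Modulo \<open>q\<close>, every function on \<open>W\<close> is congruent to its value at \<open>y\<close>. Hence an integral
    equation over \<open>k[W]\<close> becomes a monic equation over \<open>k\<close>.\<close>
  have residue: "V.scalar (?ev a) - \<sigma> a \<in> q" if a: "a \<in> W.R" for a
  proof -
    let ?p = "[:W.scalar (?ev a) - a:]"
    have "poly_over W.R ?p" by (intro const_over subring_diff[OF RW] W.scalar_in_R a)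
    moreover have "spec ?p = 0"
      by (simp add: spec_def map_poly_pCons hW0 hom_diff[OF RW hW] W.scalar_in_R a W.ev_scalar y)
    moreover have "val ?p = V.scalar (?ev a) - \<sigma> a" by (simp add: val_pCons ext.hom_simps \<sigma>_scalar)
    ultimately show ?thesis unfolding q_def by (metis (mono_tags, lifting) mem_Collect_eq)
  qed
  have Jadd: "\<And>a b. a \<in> ?J \<Longrightarrow> b \<in> ?J \<Longrightarrow> a + b \<in> ?J" and Jmult: "\<And>a b. a \<in> V.R \<Longrightarrow> b \<in> ?J \<Longrightarrow> a * b \<in> ?J"
    and J0: "0 \<in> ?J" using J(1) by (auto simp: is_ideal_def)
  have reduce: "poly (map_poly V.scalar (map_poly ?ev f)) b - poly (map_poly \<sigma> f) b \<in> ?J"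
    if "b \<in> V.R" "poly_over W.R f" for b f
    using that(2)
  proof (induction f)
    case 0
    then show ?case using J0 by simp
  next
    case (pCons a f)
    have a: "a \<in> W.R" using pCons.prems by (metis poly_over_def coeff_pCons_0)
    have f: "poly_over W.R f" using pCons.prems by (metis poly_over_def coeff_pCons_Suc)
    have "(V.scalar (?ev a) - \<sigma> a) + b * (poly (map_poly V.scalar (map_poly ?ev f)) b - poly (map_poly \<sigma> f) b) \<in> ?J"
      using residue[OF a] J(2) pCons.IH[OF f] that(1) by (intro Jadd Jmult) auto
    then show ?case
      by (simp add: map_poly_pCons hW0 ext.hom_simps V.scalar.hom_simps algebra_simps)
  qed
  define T where "T = (\<lambda>i. V.reg (\<lambda>x. x i)) ` UNIV"
  have TR: "T \<subseteq> V.R" by (auto simp: T_def polynomial_functions.coord)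
  have "\<exists>I. is_ideal V.R I \<and> ?J \<subseteq> I \<and> 1 \<notin> I \<and> (\<forall>b\<in>T. \<exists>z. b - V.scalar z \<in> I)"
  proof (rule proper_ideal_with_residues[OF RV V.ring_hom_scalar _ J(1,3) _ TR])
    show "range V.scalar \<subseteq> V.R" using V.scalar_in_R by blast
    show "finite T" by (simp add: T_def)
    fix b assume "b \<in> T"
    then have b: "b \<in> V.R" using TR by blast
    obtain f where f: "lead_coeff f = 1" "poly_over W.R f" "poly (map_poly \<sigma> f) b = 0"
      using integral_equation[OF b] by blast
    have "lead_coeff (map_poly ?ev f) = 1"
      by (rule conjunct1[OF lead_coeff_map_poly_monic[OF RW hW f(1) one_neq_zero]])
    moreover have "poly (map_poly V.scalar (map_poly ?ev f)) b \<in> ?J"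
      using reduce[OF b f(2)] f(3) by simp
    ultimately show "\<exists>p. lead_coeff p = 1 \<and> poly (map_poly V.scalar p) b \<in> ?J" by blast
  qed
  then obtain I where I: "is_ideal V.R I" "?J \<subseteq> I" "1 \<notin> I" "\<forall>b\<in>T. \<exists>z. b - V.scalar z \<in> I" by blast
  have Iadd: "\<And>a b. a \<in> I \<Longrightarrow> b \<in> I \<Longrightarrow> a + b \<in> I" and Imult: "\<And>a b. a \<in> V.R \<Longrightarrow> b \<in> I \<Longrightarrow> a * b \<in> I"
    and I0: "0 \<in> I" using I(1) by (auto simp: is_ideal_def)
  have scalar_I: "c = 0" if "V.scalar c \<in> I" for c
  proof (rule ccontr)
    assume "c \<noteq> 0"
    then have "1 = V.scalar (inverse c) * V.scalar c"
      by (simp flip: V.scalar.hom_simps(4) add: V.scalar_one)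
    then show False using Imult[OF V.scalar_in_R that] I(3) by metis
  qed
  have "\<forall>i. \<exists>z. V.reg (\<lambda>x. x i) - V.scalar z \<in> I" using I(4) by (auto simp: T_def)
  then obtain x where x: "\<And>i. V.reg (\<lambda>x. x i) - V.scalar (x i) \<in> I" by metis
  \<comment> \<open>Modulo \<open>I\<close>, every function on \<open>V\<close> is congruent to its value at \<open>x\<close>.\<close>
  have eval: "V.reg p - V.scalar (p x) \<in> I" if "p \<in> polynomial_functions" for p
    using that
  proof induction
    case (const c)
    then show ?case using I0 by (simp add: V.scalar_def)
  next
    case (coord i)
    then show ?case by (rule x)
  next
    case (add p r)
    have "V.reg (\<lambda>x. p x + r x) - V.scalar (p x + r x) = (V.reg p - V.scalar (p x)) + (V.reg r - V.scalar (r x))"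
      by (simp add: V.reg_add add.hyps V.scalar.hom_simps)
    then show ?case using Iadd[OF add.IH] by simp
  next
    case (mult p r)
    have "V.reg (\<lambda>x. p x * r x) - V.scalar (p x * r x) =
        V.reg p * (V.reg r - V.scalar (r x)) + V.scalar (r x) * (V.reg p - V.scalar (p x))"
      by (simp add: V.reg_mult mult.hyps V.scalar.hom_simps algebra_simps)
    moreover have "V.reg p * (V.reg r - V.scalar (r x)) + V.scalar (r x) * (V.reg p - V.scalar (p x)) \<in> I"
      using mult.hyps by (intro Iadd Imult mult.IH V.scalar_in_R) auto
    ultimately show ?case by simp
  qed
  have value_eq: "p x = c" if p: "p \<in> polynomial_functions" and c: "V.reg p - V.scalar c \<in> I" for p c
  proof -
    have "V.scalar (c - p x) = (V.reg p - V.scalar (p x)) + V.scalar (- 1) * (V.reg p - V.scalar c)"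
      by (simp add: V.scalar.hom_simps algebra_simps)
    also have "\<dots> \<in> I" by (intro Iadd Imult eval p c V.scalar_in_R)
    finally show ?thesis using scalar_I by fastforce
  qed
  have "x \<in> V"
  proof -
    obtain Q where Q: "Q \<subseteq> polynomial_functions" "V = zero_locus Q"
      using V_closed by (auto simp: closedin_zariski)
    have "s x = 0" if s: "s \<in> Q" for s
    proof (rule value_eq)
      show s': "s \<in> polynomial_functions" using s Q by blast
      have "V.reg s = 0" unfolding V.reg_eq_0_iff[OF s'] using s by (auto simp: Q(2) zero_locus_def)
      then show "V.reg s - V.scalar 0 \<in> I" using I0 by (simp add: V.scalar.hom_simps)
    qed
    then show ?thesis unfolding Q(2) zero_locus_def by blast
  qed
  moreover have "u x = y"
  proof
    fix i :: 'b
    have c: "(\<lambda>y. y i) \<in> polynomial_functions" by (rule polynomial_functions.coord)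
    have "V.scalar (y i) - V.reg (\<lambda>x. U x i) \<in> q"
      using residue[OF imageI[OF c]] unfolding W.ev_reg[OF y c] \<sigma>_reg[OF c] pull_def .
    then have "V.scalar (- 1) * (V.scalar (y i) - V.reg (\<lambda>x. U x i)) \<in> I"
      using J(2) I(2) by (intro Imult V.scalar_in_R) auto
    then have "V.reg (\<lambda>x. U x i) - V.scalar (y i) \<in> I" by (simp add: V.scalar.hom_simps)
    then have "U x i = y i" by (intro value_eq U_polynomial)
    then show "u x i = y i" using u_eq_U[OF \<open>x \<in> V\<close>] by simp
  qed
  moreover have "t x = z0"
  proof (rule value_eq[OF t])
    let ?p = "[:- W.scalar z0, 1:]"
    have "poly_over W.R ?p"
      by (intro poly_over_pCons poly_over_zero RW subring_one subring_uminus W.scalar_in_R)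
    moreover have "spec ?p = 0"
      by (simp add: spec_def map_poly_pCons hW0 hW1 hom_uminus[OF RW hW] W.scalar_in_R W.ev_scalar y)
    moreover have "val ?p = V.reg t - V.scalar z0"
      by (simp add: val_def map_poly_pCons ext.hom_simps \<sigma>_scalar)
    ultimately have "V.reg t - V.scalar z0 \<in> q" unfolding q_def by (metis (mono_tags, lifting) mem_Collect_eq)
    then show "V.reg t - V.scalar z0 \<in> I" using J(2) I(2) by blast
  qed
  ultimately show ?thesis by blast
qed

end

section \<open>Counting the points of a fibre\<close>

lemma enat_le_ecard_iff: "enat m \<le> ecard S \<longleftrightarrow> (\<exists>T\<subseteq>S. finite T \<and> card T = m)"
proof
  assume "enat m \<le> ecard S"
  then show "\<exists>T\<subseteq>S. finite T \<and> card T = m"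
    using infinite_arbitrarily_large[of S m]
    by (cases "finite S") (auto simp: ecard_def elim: obtain_subset_with_card_n)
next
  assume "\<exists>T\<subseteq>S. finite T \<and> card T = m"
  then show "enat m \<le> ecard S" by (auto simp: ecard_def card_mono)
qed

context separable_cover
begin

text \<open>A linear combination \<open>t\<close> of the coordinates with indices in \<open>C\<close> such that each of these coordinates lies
  in \<open>K(t)\<close>, and \<open>t\<close> separates any two points of \<open>F\<close> that one of these coordinates separates. A new
  coordinate is added with a coefficient that avoids finitely many values.\<close>

lemma separating_combination:
  assumes F: "finite F" "F \<subseteq> V" and "finite C"
  shows "\<exists>t\<in>polynomial_functions. (\<forall>i\<in>C. V.reg (\<lambda>x. x i) \<in> ext.adjoin (V.reg t)) \<and>
    (\<forall>x\<in>F. \<forall>x'\<in>F. (\<exists>i\<in>C. x i \<noteq> x' i) \<longrightarrow> t x \<noteq> t x')"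
  using assms(3)
proof (induction C rule: finite_induct)
  case empty
  show ?case by (intro bexI[of _ "\<lambda>_. 0"]) (auto intro: polynomial_functions.const)
next
  case (insert i C)
  obtain t where t: "t \<in> polynomial_functions" "\<forall>i\<in>C. V.reg (\<lambda>x. x i) \<in> ext.adjoin (V.reg t)"
    "\<forall>x\<in>F. \<forall>x'\<in>F. (\<exists>i\<in>C. x i \<noteq> x' i) \<longrightarrow> t x \<noteq> t x'"
    using insert.IH by blast
  define b where "b = V.reg (\<lambda>x. x i)"
  obtain B where B: "finite B" "\<And>c. c \<in> range \<sigma> - B \<Longrightarrow> b \<in> ext.adjoin (V.reg t + c * b)"
    using ext.primitive_combination[OF separable, of b "V.reg t"] by blast
  have "inj V.scalar" by (rule injI) (simp add: V.scalar.hom_inject)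
  then have "finite (V.scalar -` B \<union> (\<lambda>(x, x'). (t x' - t x) / (x i - x' i)) ` (F \<times> F))"
    using B(1) F(1) by (intro finite_UnI finite_vimageI finite_imageI finite_cartesian_product)
  \<comment> \<open>The quotient is the only \<open>c\<close> for which \<open>t + c x\<close>, with \<open>x\<close> the new coordinate, takes equal values
    at two points that differ in this coordinate. If they agree in it, the quotient is the
    default value \<open>0\<close>, which does no harm.\<close>
  then obtain c where c: "c \<notin> V.scalar -` B \<union> (\<lambda>(x, x'). (t x' - t x) / (x i - x' i)) ` (F \<times> F)"
    using ex_new_if_finite[OF infinite_alg_closed] by blast
  define t' where "t' = (\<lambda>x. t x + c * x i)"
  have coord: "(\<lambda>x. x i) \<in> polynomial_functions" and cc: "(\<lambda>x. c * x i) \<in> polynomial_functions"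
    by (auto intro: polynomial_functions.intros)
  have t': "t' \<in> polynomial_functions" unfolding t'_def by (intro polynomial_functions.add t(1) cc)
  have reg_t': "V.reg t' = V.reg t + V.scalar c * b"
    unfolding t'_def b_def V.scalar_def
    by (simp add: V.reg_add t(1) cc V.reg_mult[OF polynomial_functions.const coord])
  let ?K = "ext.adjoin (V.reg t')"
  note K = ext.unital_subring_adjoin[of "V.reg t'"]
  have sc: "V.scalar c \<in> range \<sigma>" using \<sigma>_scalar[of c] by (metis rangeI)
  then have bK: "b \<in> ?K" unfolding reg_t' using c by (intro B(2)) auto
  have "V.scalar c \<in> ?K" using sc ext.base_in_adjoin by auto
  then have "V.reg t' - V.scalar c * b \<in> ?K"
    by (intro subring_diff[OF K] subring_mult[OF K] ext.generator_in_adjoin bK)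
  then have "V.reg t \<in> ?K" by (simp add: reg_t')
  then have "ext.adjoin (V.reg t) \<subseteq> ?K" by (rule ext.adjoin_subset)
  then have gen: "\<forall>k\<in>insert i C. V.reg (\<lambda>x. x k) \<in> ?K"
    using t(2) bK by (auto simp: b_def)
  have "t' x \<noteq> t' x'" if x: "x \<in> F" "x' \<in> F" "\<exists>k\<in>insert i C. x k \<noteq> x' k" for x x'
  proof
    assume eq: "t' x = t' x'"
    show False
    proof (cases "x i = x' i")
      case True
      then have "t x = t x'" using eq by (simp add: t'_def)
      then show False using t(3) x True by auto
    next
      case False
      then have "c * (x i - x' i) = t x' - t x" using eq by (simp add: t'_def algebra_simps)
      then have "c = (t x' - t x) / (x i - x' i)" using False by (simp add: nonzero_eq_divide_eq)
      then show False using c x(1,2) by auto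
    qed
  qed
  then show ?case using t' gen by (intro bexI[of _ t']) auto
qed

text \<open>Taking all coordinates gives a primitive element of \<open>k(V)\<close> over \<open>k(W)\<close> that is regular on \<open>V\<close> and
  takes distinct values at the points of \<open>F\<close>.\<close>

lemma primitive_separating_function:
  assumes F: "finite F" "F \<subseteq> V"
  shows "\<exists>t\<in>polynomial_functions. \<exists>P. is_min_poly \<sigma> (V.reg t) P \<and>
    degree P = extension_degree \<sigma> \<and> inj_on t F"
proof -
  obtain t where t: "t \<in> polynomial_functions" "\<forall>i. V.reg (\<lambda>x. x i) \<in> ext.adjoin (V.reg t)"
    "\<forall>x\<in>F. \<forall>x'\<in>F. (\<exists>i. x i \<noteq> x' i) \<longrightarrow> t x \<noteq> t x'"
    using separating_combination[OF F, of UNIV] by auto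
  obtain P where P: "is_min_poly \<sigma> (V.reg t) P"
    using separable by (auto simp: separable_extension_def separable_element_def)
  let ?K = "ext.adjoin (V.reg t)"
  note K = ext.unital_subring_adjoin[of "V.reg t"]
  have reg: "V.reg p \<in> ?K" if "p \<in> polynomial_functions" for p
    using that
  proof induction
    case (const c)
    then show ?case using \<sigma>_scalar[of c] ext.base_in_adjoin by (metis V.scalar_def)
  next
    case (coord i)
    show ?case using t(2) ..
  next
    case (add p q)
    then show ?case by (simp add: V.reg_add subring_add[OF K])
  next
    case (mult p q)
    then show ?case by (simp add: V.reg_mult subring_mult[OF K])
  qed
  have "a \<in> ?K" for a
  proof -
    obtain p q where pq: "p \<in> polynomial_functions" "q \<in> polynomial_functions" "V.reg q \<noteq> 0" "a = V.reg p / V.reg q"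
      by (rule V.fraction)
    obtain m where "is_min_poly \<sigma> (V.reg q) m"
      using separable by (auto simp: separable_extension_def separable_element_def)
    then have "V.reg p * inverse (V.reg q) \<in> ?K"
      by (intro subring_mult[OF K] reg pq ext.adjoin_inverse)
    then show ?thesis by (simp add: pq(4) divide_inverse)
  qed
  then have "?K = UNIV" by blast
  then have "degree P = extension_degree \<sigma>" using ext.extension_degree_eq[OF P] by simp
  moreover have "inj_on t F"
  proof (rule inj_onI, rule ccontr)
    fix x x' assume x: "x \<in> F" "x' \<in> F" "t x = t x'" "x \<noteq> x'"
    then obtain i where "x i \<noteq> x' i" by blast
    then show False using t(3) x by blast
  qed
  ultimately show ?thesis using t(1) P by blast
qed

lemma Root_eq: "Root W jW P y = {z. poly (map_poly (W.ev y) P) z = 0}"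
  by (simp add: Root_def poly_at_def W.ev_def[abs_def])

lemma fibre_card_ge_imp:
  assumes y: "y \<in> W" and m: "enat m \<le> ecard {x\<in>V. u x = y}"
  shows "\<exists>P\<in>min_polys W jW V jV u (extension_degree \<sigma>). enat m \<le> ecard (Root W jW P y)"
proof -
  obtain F where F: "F \<subseteq> {x\<in>V. u x = y}" "finite F" "card F = m"
    using m by (auto simp: enat_le_ecard_iff)
  then have "F \<subseteq> V" by blast
  then obtain t P where t: "t \<in> polynomial_functions" and P: "is_min_poly \<sigma> (V.reg t) P"
    "degree P = extension_degree \<sigma>" and inj: "inj_on t F"
    using primitive_separating_function[OF F(2)] by blast
  have \<xi>: "V.reg t \<in> V.R" using t by blast
  have "t ` F \<subseteq> Root W jW P y"
  proof
    fix z assume "z \<in> t ` F"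
    then obtain x where x: "x \<in> V" "u x = y" "z = t x" using F(1) by blast
    have "poly (map_poly (W.ev (u x)) P) (t x) = 0"
      using P(1) by (intro root_at_point x(1) t min_poly_over_R[OF \<xi> P(1)]) (simp add: is_min_poly_def)
    then show "z \<in> Root W jW P y" by (simp add: Root_eq x)
  qed
  moreover have "card (t ` F) = m" using card_image[OF inj] F(3) by simp
  ultimately have "enat m \<le> ecard (Root W jW P y)" using F(2) by (auto simp: enat_le_ecard_iff)
  moreover have "P \<in> min_polys W jW V jV u (extension_degree \<sigma>)"
    using P t by (auto simp: min_polys_def V.reg_def coordinate_ring_def)
  ultimately show ?thesis by blast
qed

lemma root_card_le_fibre_card:
  assumes y: "y \<in> W" and P: "P \<in> min_polys W jW V jV u n" and m: "enat m \<le> ecard (Root W jW P y)"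
  shows "enat m \<le> ecard {x\<in>V. u x = y}"
proof -
  obtain t where t: "t \<in> polynomial_functions" "is_min_poly \<sigma> (V.reg t) P"
    using P by (auto simp: min_polys_def V.reg_def coordinate_ring_def)
  obtain Z where Z: "Z \<subseteq> Root W jW P y" "finite Z" "card Z = m"
    using m by (auto simp: enat_le_ecard_iff)
  have "\<forall>z\<in>Z. \<exists>x. x \<in> V \<and> u x = y \<and> t x = z"
    using point_over_root[OF y t] Z(1) by (auto simp: Root_eq)
  then obtain f where f: "\<And>z. z \<in> Z \<Longrightarrow> f z \<in> V \<and> u (f z) = y \<and> t (f z) = z" by metis
  have "inj_on f Z" by (rule inj_on_inverseI[of _ t]) (use f in auto)
  then have "card (f ` Z) = m" using card_image Z(3) by blast
  moreover have "f ` Z \<subseteq> {x\<in>V. u x = y}" using f by blast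
  ultimately show ?thesis unfolding enat_le_ecard_iff using Z(2) by blast
qed

lemma fibre_card_ge_iff:
  "{y\<in>W. enat m \<le> ecard {x\<in>V. u x = y}} = U_morphism W jW V jV u (extension_degree \<sigma>) m"
proof (intro equalityI subsetI)
  fix y assume "y \<in> {y\<in>W. enat m \<le> ecard {x\<in>V. u x = y}}"
  then show "y \<in> U_morphism W jW V jV u (extension_degree \<sigma>) m"
    using fibre_card_ge_imp[of y m] by (auto simp: U_morphism_def U_poly_def)
next
  fix y assume "y \<in> U_morphism W jW V jV u (extension_degree \<sigma>) m"
  then obtain P where "y \<in> W" "P \<in> min_polys W jW V jV u (extension_degree \<sigma>)" "enat m \<le> ecard (Root W jW P y)"
    by (auto simp: U_morphism_def U_poly_def)
  then show "y \<in> {y\<in>W. enat m \<le> ecard {x\<in>V. u x = y}}"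
    using root_card_le_fibre_card by simp
qed

lemma fibre_card_le:
  assumes y: "y \<in> W"
  shows "ecard {x\<in>V. u x = y} \<le> enat (extension_degree \<sigma>)"
proof (rule ccontr)
  let ?n = "extension_degree \<sigma>"
  assume "\<not> ?thesis"
  then have "enat (Suc ?n) \<le> ecard {x\<in>V. u x = y}" by (simp add: Suc_ile_eq)
  then obtain P where P: "P \<in> min_polys W jW V jV u ?n" "enat (Suc ?n) \<le> ecard (Root W jW P y)"
    using fibre_card_ge_imp[OF y] by blast
  let ?p = "map_poly (W.ev y) P"
  have "lead_coeff P = 1" and deg: "degree P = ?n" using P(1) by (auto simp: min_polys_def is_min_poly_def)
  then have p: "lead_coeff ?p = 1 \<and> degree ?p = ?n"
    using lead_coeff_map_poly_monic[OF W.unital_subring_R W.ring_hom_ev[OF y] _ one_neq_zero] by metis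
  then have "?p \<noteq> 0" by auto
  then have "finite {z. poly ?p z = 0}" "card {z. poly ?p z = 0} \<le> ?n"
    using poly_roots_finite[of ?p] card_poly_roots_bound[of ?p] p by auto
  then show False using P(2) by (simp add: Root_eq ecard_def)
qed

end

theorem theorem1:
  fixes V :: "('a::finite \<Rightarrow> 'k::alg_closed_field) set"
    and W :: "('b::finite \<Rightarrow> 'k) set"
    and Vh :: "('c::finite \<Rightarrow> 'k) set"
    and jV :: "(('a \<Rightarrow> 'k) \<Rightarrow> 'k) \<Rightarrow> 'v::field"
    and jW :: "(('b \<Rightarrow> 'k) \<Rightarrow> 'k) \<Rightarrow> 'w::field"
    and jH :: "(('c \<Rightarrow> 'k) \<Rightarrow> 'k) \<Rightarrow> 'h::field"
    and u :: "('a \<Rightarrow> 'k) \<Rightarrow> ('b \<Rightarrow> 'k)"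
    and u0 :: "('a \<Rightarrow> 'k) \<Rightarrow> ('c \<Rightarrow> 'k)"
    and u1 :: "('c \<Rightarrow> 'k) \<Rightarrow> ('b \<Rightarrow> 'k)"
    and n :: nat
  assumes "irreducible_affine_variety V" and "irreducible_affine_variety W"
    and "function_field V jV" and "function_field W jW"
    and "finite_morphism V W u" and "dominant_morphism V W u"
    and "n = separable_degree (function_field_embedding V jV W jW u)"
    and "normal_variety W jW"
    and "associated_variety V jV W jW u Vh jH u0 u1"
  shows "(\<forall>y\<in>W. ecard {x\<in>V. u x = y} \<le> enat n) \<and>
    {y\<in>W. ecard {x\<in>V. u x = y} = enat n} = U_morphism W jW Vh jH u1 n n \<and>
    (\<forall>m\<ge>1. {y\<in>W. enat m \<le> ecard {x\<in>V. u x = y}} = U_morphism W jW Vh jH u1 n m)"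
proof -
  note assoc = assms(9)[unfolded associated_variety_def]
  interpret cover: separable_cover Vh jH W jW u1
    using assoc assms by unfold_locales (auto simp: irreducible_affine_variety_def)
  have n: "extension_degree (function_field_embedding Vh jH W jW u1) = n"
    using assoc assms(7) by simp
  have fibre: "ecard {x\<in>V. u x = y} = ecard {x\<in>Vh. u1 x = y}" if "y \<in> W" for y
    using assoc that by blast
  have le: "ecard {x\<in>V. u x = y} \<le> enat n" if "y \<in> W" for y
    using cover.fibre_card_le[OF that] by (simp add: fibre that n)
  have ge: "{y\<in>W. enat m \<le> ecard {x\<in>V. u x = y}} = U_morphism W jW Vh jH u1 n m" for m
  proof -
    have "{y\<in>W. enat m \<le> ecard {x\<in>V. u x = y}} = {y\<in>W. enat m \<le> ecard {x\<in>Vh. u1 x = y}}"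
      using fibre by auto
    then show ?thesis by (simp only: cover.fibre_card_ge_iff n)
  qed
  have "{y\<in>W. ecard {x\<in>V. u x = y} = enat n} = {y\<in>W. enat n \<le> ecard {x\<in>V. u x = y}}"
    using le by (auto intro: antisym)
  then show ?thesis using le ge by simp
qed

end
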